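(* Let $\overline{x}$ be a feasible point of the SDCMPCC $\min_x\{\varphi(x)\ \text{s.t.}\ \Upsilon(x)\in K\times\Omega\}$ with $\mathcal{M}(\overline{x})\neq\emptyset$. Suppose that for every $d\in\mathcal{C}(\overline{x})\setminus\{0\}$, \[ \sup_{(\xi,\Gamma)\in\mathcal{M}(\overline{x})}\Big\{\langle d,\nabla^2_{xx}L(\overline{x},\xi,\Gamma)d\rangle-\sigma\big((\xi,\Gamma)\mid\mathcal{T}^2_{K\times\Omega}(\Upsilon(\overline{x});\Upsilon'(\overline{x})d)\big)\Big\}>0, \] and that for every $d\in\mathcal{C}(\overline{x})$ the multifunction $\mathcal{H}(X,Y):=(X;Y;\langle X,Y\rangle)-\mathbb{S}^n_+\times\mathbb{S}^n_-\times\mathbb{R}_+$ is metrically subregular at $\Theta(\overline{x})$ for the origin in the direction $\Theta'(\overline{x})d$. Then there exist $\kappa>0$ and $\delta>0$ such that $\varphi(x)\ge\varphi(\overline{x})+\kappa\|x-\overline{x}\|^2$ for all feasible $x$ with $\|x-\overline{x}\|\le\delta$.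
   Context: Standing setting: $\mathbb{X},\mathbb{Y}$ finite-dimensional real inner product spaces; $\mathbb{S}^n$ the real symmetric $n\times n$ matrices with trace inner product; $\mathbb{S}^n_\pm$ the positive/negative semidefinite cones. $\varphi:\mathbb{X}\to\mathbb{R}$, $h:\mathbb{X}\to\mathbb{Y}$, $\theta,\zeta:\mathbb{X}\to\mathbb{S}^n$ twice differentiable; $K\subseteq\mathbb{Y}$ a closed convex cone which is second-order regular (i.e., at each $y\in K$ and each $v\in\mathcal{T}_K(y)$: $\mathcal{T}^2_K(y;v)$ equals the inner second-order tangent set, and for any $y+t_kv+\frac12t_k^2w^k\in K$ with $t_k\downarrow0$, $t_kw^k\to0$ one has $\mathrm{dist}(w^k,\mathcal{T}^2_K(y;v))\to0$). $\Omega:=\{(X,Y)\mid X\in\mathbb{S}^n_+,Y\in\mathbb{S}^n_-,\langle X,Y\rangle=0\}$, $\Theta(x)=(\theta(x),\zeta(x))$, $\Upsilon(x)=(h(x),\Theta(x))$. For a closed set $C$ at $y\in C$: Bouligand tangent cone $\mathcal{T}_C(y)$; regular normal cone $\widehat{\mathcal{N}}_C(y)=[\mathcal{T}_C(y)]^\circ$; limiting normal cone $\mathcal{N}_C(y)=\{v\mid\exists y^k\to y\text{ in }C,\ v^k\to v,\ v^k\in\widehat{\mathcal{N}}_C(y^k)\}$; outer second-order tangent set $\mathcal{T}^2_C(y;v)=\{w\mid\exists t_k\downarrow0,\ \mathrm{dist}(y+t_kv+\tfrac12t_k^2w,C)=o(t_k^2)\}$. $\sigma(\cdot\mid T)$ is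 the support function. Critical cone $\mathcal{C}(x)=\{d\mid\varphi'(x)d\le0,\ \Upsilon'(x)d\in\mathcal{T}_{K\times\Omega}(\Upsilon(x))\}$; Lagrangian $L(x,\xi,\Gamma)=\varphi(x)+\langle\xi,h(x)\rangle+\langle\Gamma,\Theta(x)\rangle$; $\mathcal{M}(x)=\{(\xi,\Gamma)\in\mathbb{Y}\times(\mathbb{S}^n\times\mathbb{S}^n)\mid\nabla_xL(x,\xi,\Gamma)=0,\ (\xi,\Gamma)\in\mathcal{N}_{K\times\Omega}(\Upsilon(x))\}$. A multifunction $\mathcal{G}(z)=\Psi(z)-D$ ($D$ closed) is metrically subregular at $\overline{z}$ for the origin in direction $u$ if there are $\kappa,\rho,\delta>0$ with $\mathrm{dist}(z,\mathcal{G}^{-1}(0))\le\kappa\,\mathrm{dist}(\Psi(z),D)$ for all $z\in\overline{z}+V_{\rho,\delta}$, $V_{\rho,\delta}=\{w\mid\|w\|\le\rho,\ \|\,\|u\|w-\|w\|u\|\le\delta\|w\|\|u\|\}$. *)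

theory Defs
  imports "HOL-Analysis.Analysis"
begin

definition bouligand_tangent_cone :: "'a::real_normed_vector set \<Rightarrow> 'a \<Rightarrow> 'a set" where
  "bouligand_tangent_cone C y =
     {d. \<exists>t dd. (\<forall>k. 0 < t k) \<and> t \<longlonglongrightarrow> 0 \<and> dd \<longlonglongrightarrow> d \<and> (\<forall>k. y + t k *\<^sub>R dd k \<in> C)}"

text \<open>Regular normal cone, taken inside an ambient linear subspace V (the polar of the
  tangent cone computed in V); V = whole space gives the usual notion.\<close>
definition regular_normal_cone :: "'a::real_inner set \<Rightarrow> 'a set \<Rightarrow> 'a \<Rightarrow> 'a set" where
  "regular_normal_cone V C y = {v \<in> V. \<forall>w \<in> bouligand_tangent_cone C y. inner v w \<le> 0}"

definition limiting_normal_cone :: "'a::real_inner set \<Rightarrow> 'a set \<Rightarrow> 'a \<Rightarrow> 'a set" where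
  "limiting_normal_cone V C y =
     {v. \<exists>yy vv. (\<forall>k. yy k \<in> C) \<and> yy \<longlonglongrightarrow> y \<and> vv \<longlonglongrightarrow> v \<and>
                 (\<forall>k. vv k \<in> regular_normal_cone V C (yy k))}"

definition outer_tangent2 :: "'a::real_normed_vector set \<Rightarrow> 'a \<Rightarrow> 'a \<Rightarrow> 'a set" where
  "outer_tangent2 C y v =
     {w. \<exists>t. (\<forall>k. 0 < t k) \<and> t \<longlonglongrightarrow> 0 \<and>
            (\<lambda>k. infdist (y + t k *\<^sub>R v + ((t k)\<^sup>2 / 2) *\<^sub>R w) C / (t k)\<^sup>2) \<longlonglongrightarrow> 0}"

definition inner_tangent2 :: "'a::real_normed_vector set \<Rightarrow> 'a \<Rightarrow> 'a \<Rightarrow> 'a set" where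
  "inner_tangent2 C y v =
     {w. ((\<lambda>t. infdist (y + t *\<^sub>R v + (t\<^sup>2 / 2) *\<^sub>R w) C / t\<^sup>2) \<longlongrightarrow> 0) (at_right 0)}"

text \<open>Second-order regularity.  The condition dist(w^k, T) \<rightarrow> 0 is written so that it
  is correct also for an empty T (distance +\<infinity>).\<close>
definition second_order_regular :: "'a::real_normed_vector set \<Rightarrow> bool" where
  "second_order_regular K \<longleftrightarrow>
     (\<forall>y \<in> K. \<forall>v \<in> bouligand_tangent_cone K y.
        outer_tangent2 K y v = inner_tangent2 K y v \<and>
        (\<forall>t w. (\<forall>k. 0 < t k) \<and> t \<longlonglongrightarrow> 0 \<and>
               (\<forall>k. y + t k *\<^sub>R v + ((t k)\<^sup>2 / 2) *\<^sub>R w k \<in> K) \<and>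
               (\<lambda>k. t k *\<^sub>R w k) \<longlonglongrightarrow> 0 \<longrightarrow>
               (\<forall>e>0. eventually (\<lambda>k. \<exists>z \<in> outer_tangent2 K y v. dist (w k) z < e) sequentially)))"

text \<open>Support function (extended-real valued; sup over the empty set is -\<infinity>).\<close>
definition support_fun :: "'a::real_inner \<Rightarrow> 'a set \<Rightarrow> ereal" where
  "support_fun u T = (SUP w \<in> T. ereal (inner u w))"

section \<open>Symmetric matrices (trace inner product = the library inner product on real^'n^'n)\<close>

definition sym_mats :: "(real^'n^'n) set" where
  "sym_mats = {X. transpose X = X}"

definition psd_cone :: "(real^'n^'n) set" where
  "psd_cone = {X. transpose X = X \<and> (\<forall>v. 0 \<le> inner v (X *v v))}"

definition nsd_cone :: "(real^'n^'n) set" where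
  "nsd_cone = {X. transpose X = X \<and> (\<forall>v. inner v (X *v v) \<le> 0)}"

definition Omega_set :: "((real^'n^'n) \<times> (real^'n^'n)) set" where
  "Omega_set = {(X, Y). X \<in> psd_cone \<and> Y \<in> nsd_cone \<and> inner X Y = 0}"

definition dir_nbhd :: "real \<Rightarrow> real \<Rightarrow> 'a::real_normed_vector \<Rightarrow> 'a set" where
  "dir_nbhd \<rho> \<delta> u = {w. norm w \<le> \<rho> \<and> norm (norm u *\<^sub>R w - norm w *\<^sub>R u) \<le> \<delta> * norm w * norm u}"

text \<open>G(z) = Psi(z) - D on the domain A (a linear space), metrically subregular at zbar
  for the origin in direction u.\<close>
definition dir_metric_subregular ::
  "'a::real_normed_vector set \<Rightarrow> ('a \<Rightarrow> 'b::real_normed_vector) \<Rightarrow> 'b set \<Rightarrow> 'a \<Rightarrow> 'a \<Rightarrow> bool" where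
  "dir_metric_subregular A Psi D zbar u \<longleftrightarrow>
     (\<exists>\<kappa>>0. \<exists>\<rho>>0. \<exists>\<delta>>0. \<forall>w \<in> dir_nbhd \<rho> \<delta> u. zbar + w \<in> A \<longrightarrow>
        infdist (zbar + w) {z \<in> A. Psi z \<in> D} \<le> \<kappa> * infdist (Psi (zbar + w)) D)"

definition H_map :: "(real^'n^'n) \<times> (real^'n^'n) \<Rightarrow> (real^'n^'n) \<times> (real^'n^'n) \<times> real" where
  "H_map Z = (fst Z, snd Z, inner (fst Z) (snd Z))"

definition H_set :: "((real^'n^'n) \<times> (real^'n^'n) \<times> real) set" where
  "H_set = psd_cone \<times> nsd_cone \<times> {0..}"

definition lagrangian ::
  "('x \<Rightarrow> real) \<Rightarrow> ('x \<Rightarrow> 'y::real_inner) \<Rightarrow> ('x \<Rightarrow> real^'n^'n) \<Rightarrow> ('x \<Rightarrow> real^'n^'n)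
   \<Rightarrow> 'x \<Rightarrow> 'y \<times> ((real^'n^'n) \<times> (real^'n^'n)) \<Rightarrow> real" where
  "lagrangian phi h theta zeta x m =
     phi x + inner (fst m) (h x) + inner (snd m) (theta x, zeta x)"

end

theory Submission
  imports Defs "HOL-Real_Asymp.Real_Asymp"
begin

text \<open>
  Suppose quadratic growth fails along feasible \<open>x\<^sub>k\<close> with \<open>t\<^sub>k = \<parallel>x\<^sub>k - xbar\<parallel> \<rightarrow> 0\<close> and
  \<open>(x\<^sub>k - xbar) / t\<^sub>k \<rightarrow> d\<close>.  Then \<open>d\<close> is critical.  Write the image of \<open>x\<^sub>k\<close> under the constraint map
  as \<open>y + t\<^sub>k v + (t\<^sub>k\<^sup>2 / 2) w\<^sub>k\<close>, where \<open>v\<close> is the image of \<open>d\<close> and \<open>t\<^sub>k w\<^sub>k \<rightarrow> 0\<close>.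

  The distance of \<open>w\<^sub>k\<close> to the second-order tangent set \<open>T\<close> of \<open>K \<times> \<Omega>\<close> at \<open>y\<close> in direction \<open>v\<close> tends
  to \<open>0\<close>.  For \<open>K\<close> this is second-order regularity.  For \<open>\<Omega>\<close>, if \<open>X + t\<^sub>k V + (t\<^sub>k\<^sup>2 / 2) W\<^sub>k\<close> is
  positive semidefinite for all \<open>k\<close>, then for every \<open>\<epsilon> > 0\<close> and large \<open>k\<close> so is
  \<open>X + s V + (s\<^sup>2 / 2) (W\<^sub>k + \<epsilon> I)\<close> for all \<open>0 < s \<le> t\<^sub>k\<close>; hence the parabola with fixed \<open>W\<^sub>k\<close> stays
  within \<open>O(\<epsilon> s\<^sup>2)\<close> of satisfying the constraints defining \<open>\<Omega>\<close>, and directional subregularity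
  moves it into \<open>\<Omega>\<close>.

  The set \<open>T\<close> is invariant under adding multiples of \<open>v\<close>.  Hence a multiplier \<open>m\<close> for which the
  expression in the second-order condition is positive, and so \<open>\<sigma>(m | T) < \<infinity>\<close>, is orthogonal to \<open>v\<close>.
  The expansion of the Lagrangian then gives that the lower limit of \<open>\<langle>m, w\<^sub>k\<rangle>\<close> is at least
  \<open>\<langle>d, \<nabla>\<^sup>2L d\<rangle> > \<sigma>(m | T)\<close>, contradicting that \<open>w\<^sub>k\<close> approaches \<open>T\<close>.
\<close>

section \<open>Positive semidefinite matrices\<close>

lemma norm_matrix_vector_mult_le:
  fixes A :: "real^'n^'m"
  shows "norm (A *v x) \<le> norm A * norm x"
proof -
  have "norm ((A *v x) $ i) \<le> norm (A $ i) * norm x" for i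
    using Cauchy_Schwarz_ineq2[of "A $ i" x] by (simp add: matrix_vector_mul_component)
  then have "norm (A *v x) \<le> L2_set (\<lambda>i. norm (A $ i) * norm x) UNIV"
    unfolding norm_vec_def[of "A *v x"] by (intro L2_set_mono) auto
  also have "\<dots> = norm A * norm x"
    by (simp add: norm_vec_def[of A] L2_set_left_distrib)
  finally show ?thesis .
qed

lemma abs_inner_matrix_vector_le:
  fixes A :: "real^'n^'m"
  shows "\<bar>inner x (A *v y)\<bar> \<le> norm A * norm x * norm y"
proof -
  have "\<bar>inner x (A *v y)\<bar> \<le> norm x * norm (A *v y)"
    by (rule Cauchy_Schwarz_ineq2)
  also have "\<dots> \<le> norm x * (norm A * norm y)"
    by (intro mult_left_mono norm_matrix_vector_mult_le) auto
  finally show ?thesis by (simp add: mult_ac)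
qed

lemma inner_symmetric_matrix:
  fixes A :: "real^'n^'n"
  assumes "transpose A = A"
  shows "inner x (A *v y) = inner y (A *v x)"
  by (metis assms dot_lmul_matrix inner_commute transpose_matrix_vector)

lemma matrix_vector_mult_uminus_left: "(- A) *v x = - (A *v (x :: real^'n))" for A :: "real^'n^'m"
  by (simp add: vec_eq_iff matrix_vector_mul_component)

lemma subspace_sym_mats: "subspace (sym_mats :: (real^'n^'n) set)"
  unfolding subspace_def sym_mats_def by (auto simp: transpose_def vec_eq_iff)

lemma quadratic_form_add:
  fixes A :: "real^'n^'n"
  assumes "transpose A = A"
  shows "inner (x + r *\<^sub>R y) (A *v (x + r *\<^sub>R y))
    = inner x (A *v x) + 2 * r * inner x (A *v y) + r\<^sup>2 * inner y (A *v y)"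
  using inner_symmetric_matrix[OF assms, of y x]
  by (simp add: matrix_vector_right_distrib matrix_vector_mult_scaleR inner_add_left inner_add_right
      power2_eq_square algebra_simps)

text \<open>The form at \<open>x + r *\<^sub>R y\<close> is a nonnegative quadratic polynomial in
  \<open>r\<close>. For \<open>?c > 0\<close> its value at the minimiser \<open>- ?b / ?c\<close>
  gives the claim; for \<open>?c = 0\<close> it is affine, hence constant.\<close>

lemma psd_Cauchy_Schwarz:
  fixes A :: "real^'n^'n"
  assumes "A \<in> psd_cone"
  shows "(inner x (A *v y))\<^sup>2 \<le> inner x (A *v x) * inner y (A *v y)"
proof -
  let ?a = "inner x (A *v x)" and ?b = "inner x (A *v y)" and ?c = "inner y (A *v y)"
  have sym: "transpose A = A" and nn: "0 \<le> inner v (A *v v)" for v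
    using assms by (auto simp: psd_cone_def)
  have q: "0 \<le> ?a + 2 * r * ?b + r\<^sup>2 * ?c" for r
    using nn[of "x + r *\<^sub>R y"] quadratic_form_add[OF sym, of x r y] by simp
  show ?thesis
  proof (cases "?c = 0")
    case True
    have "?b = 0"
    proof (rule ccontr)
      assume "?b \<noteq> 0"
      \<comment> \<open>At this \<open>r\<close> the affine polynomial takes the value -1.\<close>
      then show False using q[of "- (?a + 1) / (2 * ?b)"] True by (simp add: field_simps)
    qed
    then show ?thesis using True by simp
  next
    case False
    then have "?c > 0" using nn[of y] by simp
    then show ?thesis using q[of "- ?b / ?c"]
      by (simp add: field_simps power2_eq_square)
  qed
qed

text \<open>Cauchy-Schwarz is tested against \<open>A *v x\<close> itself, so that its left side is
  the fourth power of the norm of \<open>A *v x\<close>.\<close>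

lemma psd_quadratic_form_eq_0:
  fixes A :: "real^'n^'n"
  assumes "A \<in> psd_cone" "inner x (A *v x) = 0"
  shows "A *v x = 0"
proof -
  have "(inner (A *v x) (A *v x))\<^sup>2 \<le> 0"
    using psd_Cauchy_Schwarz[OF assms(1), of "A *v x" x] assms(2) by simp
  then show ?thesis by simp
qed

section \<open>Trace inner product of semidefinite matrices and the complementarity set\<close>

lemma entry_eq_quadratic_form:
  fixes A :: "real^'n^'n"
  shows "inner (axis i 1) (A *v axis j 1) = A $ i $ j"
  by (simp add: inner_axis' matrix_vector_mul_component inner_axis)

lemma inner_outer_product:
  fixes B :: "real^'n^'n"
  shows "inner (\<chi> i j. c $ i * c $ j) B = inner c (B *v c)"
  by (simp add: inner_vec_def matrix_vector_mult_def sum_distrib_left mult_ac)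

lemma outer_product_mult_vector:
  "(\<chi> i j. c $ i * c $ j) *v v = inner c v *\<^sub>R (c :: real^'n)"
  by (simp add: vec_eq_iff inner_vec_def matrix_vector_mult_def sum_distrib_left mult_ac)

text \<open>Each step of symmetric Gaussian elimination splits off a positive semidefinite matrix of
  rank one, whose inner product with \<open>B\<close> is a value of the quadratic form of \<open>B\<close>.\<close>
lemma inner_psd_psd_nonneg:
  fixes A B :: "real^'n^'n"
  assumes "A \<in> psd_cone" "B \<in> psd_cone"
  shows "0 \<le> inner A B"
  using assms(1)
proof (induction "card {i. A $ i $ i \<noteq> 0}" arbitrary: A rule: less_induct)
  case less
  have sym: "transpose A = A" and nn: "0 \<le> inner v (A *v v)" for v
    using less.prems by (auto simp: psd_cone_def)
  show ?case
  proof (cases "\<exists>i. A $ i $ i \<noteq> 0")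
    case False
    have "(A $ i $ j)\<^sup>2 \<le> 0" for i j
      using psd_Cauchy_Schwarz[OF less.prems, of "axis i 1" "axis j 1"] False
      by (simp add: entry_eq_quadratic_form)
    then have "A = 0" by (simp add: vec_eq_iff)
    then show ?thesis by simp
  next
    case True
    then obtain p where p: "A $ p $ p \<noteq> 0" by blast
    then have pp: "A $ p $ p > 0"
      using nn[of "axis p 1"] by (simp add: entry_eq_quadratic_form)
    \<comment> \<open>With this normalisation the rank-one matrix of \<open>c\<close> has the same
      column \<open>p\<close> as \<open>A\<close>, so row and column \<open>p\<close> of
      \<open>A'\<close> vanish. That \<open>A'\<close> stays positive semidefinite is
      Cauchy-Schwarz.\<close>
    define c where "c = (1 / sqrt (A $ p $ p)) *\<^sub>R (A *v axis p 1)"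
    define A' where "A' = A - (\<chi> i j. c $ i * c $ j)"
    have ccp: "c $ i = A $ i $ p / sqrt (A $ p $ p)" for i
      by (simp add: c_def matrix_vector_mul_component inner_axis)
    have "A' \<in> psd_cone"
    proof -
      have "transpose A' = A'"
        using sym by (simp add: A'_def vec_eq_iff transpose_def mult.commute)
      moreover have "0 \<le> inner v (A' *v v)" for v
      proof -
        have "(inner v (A *v axis p 1))\<^sup>2 \<le> inner v (A *v v) * A $ p $ p"
          using psd_Cauchy_Schwarz[OF less.prems, of v "axis p 1"] by (simp add: entry_eq_quadratic_form)
        moreover have "inner c v = inner v (A *v axis p 1) / sqrt (A $ p $ p)"
          by (simp add: c_def inner_commute)
        moreover from this have "(inner c v)\<^sup>2 = (inner v (A *v axis p 1))\<^sup>2 / A $ p $ p"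
          using pp by (simp add: power_divide)
        ultimately have "(inner c v)\<^sup>2 \<le> inner v (A *v v)"
          using pp by (simp add: pos_divide_le_eq)
        then show ?thesis
          by (simp add: A'_def matrix_vector_mult_diff_rdistrib outer_product_mult_vector inner_diff_right
              power2_eq_square inner_commute)
      qed
      ultimately show ?thesis by (simp add: psd_cone_def)
    qed
    moreover have "{i. A' $ i $ i \<noteq> 0} \<subset> {i. A $ i $ i \<noteq> 0}"
    proof
      show "{i. A' $ i $ i \<noteq> 0} \<subseteq> {i. A $ i $ i \<noteq> 0}"
      proof clarify
        fix i assume i: "A' $ i $ i \<noteq> 0" "A $ i $ i = 0"
        \<comment> \<open>A zero diagonal entry forces \<open>A $ i $ p\<close> to vanish, so the
          subtraction creates no new nonzero diagonal entry.\<close>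
        have "(A $ i $ p)\<^sup>2 \<le> 0"
          using psd_Cauchy_Schwarz[OF less.prems, of "axis i 1" "axis p 1"] i
          by (simp add: entry_eq_quadratic_form)
        then show False using i by (simp add: A'_def ccp)
      qed
      have "A' $ p $ p = 0" using pp by (simp add: A'_def ccp)
      then show "{i. A' $ i $ i \<noteq> 0} \<noteq> {i. A $ i $ i \<noteq> 0}" using p by blast
    qed
    ultimately have "0 \<le> inner A' B"
      using less.hyps[of A'] by (simp add: psubset_card_mono)
    moreover have "inner A B = inner A' B + inner c (B *v c)"
      by (simp add: A'_def inner_diff_left inner_outer_product)
    moreover have "0 \<le> inner c (B *v c)" using assms(2) by (simp add: psd_cone_def)
    ultimately show ?thesis by simp
  qed
qed

lemma uminus_mem_psd_cone [simp]: "- Y \<in> psd_cone \<longleftrightarrow> Y \<in> nsd_cone"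
  by (auto simp: psd_cone_def nsd_cone_def matrix_vector_mult_uminus_left transpose_def vec_eq_iff)

text \<open>The trace product of a positive and a negative semidefinite matrix is at most 0, so the
  one-sided constraint \<open>{0..}\<close> in \<open>H_set\<close> already forces complementarity.
  Hence subregularity of \<open>H_map\<close> estimates the distance to
  \<open>Omega_set\<close>.\<close>

lemma Omega_set_eq_H_map_vimage:
  "{Z \<in> sym_mats \<times> sym_mats. H_map Z \<in> H_set} = (Omega_set :: ((real^'n^'n) \<times> (real^'n^'n)) set)"
proof -
  have "inner X Y \<le> 0" if "X \<in> psd_cone" "Y \<in> nsd_cone" for X Y :: "real^'n^'n"
    using inner_psd_psd_nonneg[of X "- Y"] that by simp
  then show ?thesis
    by (auto simp: H_map_def H_set_def Omega_set_def sym_mats_def psd_cone_def nsd_cone_def order_antisym)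
qed

section \<open>Positive semidefinite parabolas at smaller parameters\<close>

text \<open>The form attains its minimum on the compact set of unit vectors orthogonal to the
  kernel. The minimum is positive, since a zero of the form lies in the kernel and would be
  orthogonal to itself.\<close>

lemma psd_coercive_on_kernel_complement:
  fixes A :: "real^'n^'n"
  assumes "A \<in> psd_cone"
  obtains c where "c > 0"
    "\<And>r. (\<And>e. A *v e = 0 \<Longrightarrow> inner r e = 0) \<Longrightarrow> c * (norm r)\<^sup>2 \<le> inner r (A *v r)"
proof -
  define S where "S = {r. norm r = 1 \<and> (\<forall>e\<in>{e. A *v e = 0}. inner r e = 0)}"
  have S_eq: "S = sphere 0 1 \<inter> (\<Inter>e\<in>{e. A *v e = 0}. {r. inner r e = 0})"
    by (auto simp: S_def)
  have "closed {r. inner r e = 0}" for e :: "real^'n"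
    by (intro closed_Collect_eq continuous_intros)
  then have "compact S" unfolding S_eq by (intro compact_Int_closed closed_INT) auto
  show ?thesis
  proof (cases "S = {}")
    case True
    \<comment> \<open>The kernel is the whole space, so only \<open>r = 0\<close> is tested and any
      positive constant serves.\<close>
    show ?thesis
    proof (rule that[of 1])
      fix r assume r: "\<And>e. A *v e = 0 \<Longrightarrow> inner r e = 0"
      have "r = 0"
      proof (rule ccontr)
        assume "r \<noteq> 0"
        then have "r /\<^sub>R norm r \<in> S" using r by (simp add: S_def)
        then show False using True by blast
      qed
      then show "1 * (norm r)\<^sup>2 \<le> inner r (A *v r)" by simp
    qed simp
  next
    case False
    have "continuous_on S (\<lambda>r. inner r (A *v r))"
      by (intro continuous_intros linear_continuous_on matrix_vector_mul_bounded_linear)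
    then obtain s where s: "s \<in> S" and min: "\<And>r. r \<in> S \<Longrightarrow> inner s (A *v s) \<le> inner r (A *v r)"
      using continuous_attains_inf[OF \<open>compact S\<close> False] by metis
    show ?thesis
    proof (rule that[of "inner s (A *v s)"])
      have "inner s (A *v s) \<noteq> 0"
      proof
        assume "inner s (A *v s) = 0"
        then have "A *v s = 0" using psd_quadratic_form_eq_0[OF assms] by blast
        then have "inner s s = 0" using s by (simp add: S_def)
        then show False using s by (simp add: S_def)
      qed
      then show "inner s (A *v s) > 0" using assms by (simp add: psd_cone_def less_le)
      fix r assume r: "\<And>e. A *v e = 0 \<Longrightarrow> inner r e = 0"
      show "inner s (A *v s) * (norm r)\<^sup>2 \<le> inner r (A *v r)"
      proof (cases "r = 0")
        case False
        then have "r /\<^sub>R norm r \<in> S" using r by (simp add: S_def)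
        from min[OF this] have "inner s (A *v s) \<le> inner r (A *v r) / (norm r)\<^sup>2"
          by (simp add: matrix_vector_mult_scaleR power2_eq_square divide_simps)
        then show ?thesis using False by (simp add: field_simps)
      qed simp
    qed
  qed
qed

text \<open>The quadratic form of \<open>X + t V + (t\<^sup>2 / 2) W\<close> at \<open>a + t b\<close>, for \<open>a\<close> in the kernel of \<open>X\<close>,
  divided by \<open>t\<^sup>2\<close>.  Passing from the parameter \<open>T\<close> to a smaller \<open>t\<close> only increases the leading
  term \<open>\<alpha> / t\<close>; large \<open>b\<close> are dominated by \<open>\<beta>\<close> and are compared with \<open>b = 0\<close>.\<close>
lemma rescaled_form_lower_bound:
  fixes \<alpha> \<beta> \<gamma> \<nu> w1 w2 w3 t T c B \<delta> \<eta> x y :: real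
  assumes t: "0 < t" "t \<le> T" and c: "0 < c" and x: "0 \<le> x" and y: "0 \<le> y"
    and \<alpha>: "0 \<le> \<alpha>" and \<beta>: "c * y\<^sup>2 \<le> \<beta>" and B: "0 \<le> B" and \<delta>: "0 \<le> \<delta>" "\<delta> \<le> 1"
    and \<gamma>: "\<bar>\<gamma>\<bar> \<le> B * x * y" and \<nu>: "\<bar>\<nu>\<bar> \<le> B * y\<^sup>2"
    and w2: "T * \<bar>w2\<bar> \<le> \<delta> * x * y" and w3: "T * \<bar>w3\<bar> \<le> \<delta> * y\<^sup>2"
    and nn: "0 \<le> \<alpha> / T + \<beta> + 2 * \<gamma> + T * \<nu> + w1 / 2 + T * w2 + T\<^sup>2 / 2 * w3"
    and nn0: "0 \<le> \<alpha> / T + w1 / 2"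
    and small: "T * B + T * \<delta> / 2 \<le> c / 2"
    and R: "R = 2 * (2 * B + 1) / c"
    and small': "T * B * R\<^sup>2 + \<delta> * R + T * \<delta> / 2 * R\<^sup>2 \<le> \<eta>"
  shows "- \<eta> * x\<^sup>2 \<le> \<alpha> / t + \<beta> + 2 * \<gamma> + t * \<nu> + w1 / 2 + t * w2 + t\<^sup>2 / 2 * w3"
proof -
  have "T > 0" using t by simp
  have "R \<ge> 0" using R B c by simp
  have le: "\<alpha> / T \<le> \<alpha> / t" using t \<alpha> by (simp add: frac_le)
  \<comment> \<open>Two parameters serve both cases below: differences between \<open>T\<close> and
    \<open>t\<close> when \<open>y\<close> is small, and the terms at \<open>t\<close> alone, with
    \<open>q = 0\<close>, when it is large.\<close>
  have bd: "\<bar>r * \<nu>\<bar> \<le> T * B * y\<^sup>2" "\<bar>r * w2\<bar> \<le> \<delta> * x * y" "\<bar>r\<^sup>2 / 2 * w3 - q\<^sup>2 / 2 * w3\<bar> \<le> T * \<delta> / 2 * y\<^sup>2"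
    if "0 \<le> r" "r \<le> T" "0 \<le> q" "q \<le> T" for r q
  proof -
    have "r * \<bar>\<nu>\<bar> \<le> T * (B * y\<^sup>2)" using that \<nu> by (intro mult_mono) auto
    then show "\<bar>r * \<nu>\<bar> \<le> T * B * y\<^sup>2" using that by (simp add: abs_mult)
    have "r * \<bar>w2\<bar> \<le> T * \<bar>w2\<bar>" using that by (intro mult_right_mono) auto
    then show "\<bar>r * w2\<bar> \<le> \<delta> * x * y" using that w2 by (simp add: abs_mult)
    have "\<bar>r\<^sup>2 - q\<^sup>2\<bar> \<le> T * T"
      using power_mono[OF that(2,1), of 2] power_mono[OF that(4,3), of 2]
        zero_le_power2[of r] zero_le_power2[of q] unfolding power2_eq_square by linarith
    then have "\<bar>r\<^sup>2 - q\<^sup>2\<bar> * \<bar>w3\<bar> \<le> T * T * \<bar>w3\<bar>" by (intro mult_right_mono) auto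
    also have "\<dots> \<le> T * (\<delta> * y\<^sup>2)"
      using mult_left_mono[OF w3, of T] \<open>T > 0\<close> by (simp add: mult.assoc)
    finally have "\<bar>r\<^sup>2 - q\<^sup>2\<bar> * \<bar>w3\<bar> / 2 \<le> T * \<delta> / 2 * y\<^sup>2" by simp
    moreover have "\<bar>r\<^sup>2 / 2 * w3 - q\<^sup>2 / 2 * w3\<bar> = \<bar>(r\<^sup>2 - q\<^sup>2) * w3\<bar> / 2"
      by (simp add: left_diff_distrib diff_divide_distrib[symmetric])
    ultimately show "\<bar>r\<^sup>2 / 2 * w3 - q\<^sup>2 / 2 * w3\<bar> \<le> T * \<delta> / 2 * y\<^sup>2" by (simp add: abs_mult)
  qed
  show ?thesis
  proof (cases "y \<le> R * x")
    case True
    \<comment> \<open>The expression at \<open>t\<close> is compared with the nonnegative one at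
      \<open>T\<close>; as \<open>y\<close> is at most \<open>R * x\<close>, the changes add up to
      at most \<open>\<eta> * x\<^sup>2\<close>.\<close>
    have "\<delta> * x * y \<le> \<delta> * x * (R * x)" using True \<delta> x by (intro mult_left_mono) auto
    moreover have "y\<^sup>2 \<le> (R * x)\<^sup>2" using True y by (rule power_mono)
    then have "T * B * y\<^sup>2 \<le> T * B * (R * x)\<^sup>2" "T * \<delta> / 2 * y\<^sup>2 \<le> T * \<delta> / 2 * (R * x)\<^sup>2"
      using \<open>T > 0\<close> B \<delta> by (auto intro!: mult_left_mono)
    moreover have "(T * B * R\<^sup>2 + \<delta> * R + T * \<delta> / 2 * R\<^sup>2) * x\<^sup>2 \<le> \<eta> * x\<^sup>2"
      using small' by (rule mult_right_mono) simp
    moreover have "(T * B * R\<^sup>2 + \<delta> * R + T * \<delta> / 2 * R\<^sup>2) * x\<^sup>2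
        = T * B * (R * x)\<^sup>2 + \<delta> * x * (R * x) + T * \<delta> / 2 * (R * x)\<^sup>2"
      by (simp add: power2_eq_square algebra_simps)
    moreover have "\<bar>(T - t) * \<nu>\<bar> \<le> T * B * y\<^sup>2" "\<bar>(T - t) * w2\<bar> \<le> \<delta> * x * y"
        "\<bar>T\<^sup>2 / 2 * w3 - t\<^sup>2 / 2 * w3\<bar> \<le> T * \<delta> / 2 * y\<^sup>2"
      using bd(1,2)[of "T - t" 0] bd(3)[of T t] t by auto
    ultimately show ?thesis using nn le unfolding left_diff_distrib by linarith
  next
    case False
    \<comment> \<open>This is what \<open>R\<close> is chosen for: the mixed terms, at most
      \<open>(2 * B + 1) * x * y\<close>, cost half of \<open>c * y\<^sup>2\<close>, and by
      \<open>small\<close> the terms with \<open>\<nu>\<close> and \<open>w3\<close> cost at most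
      the other half. What remains is \<open>\<alpha> / t + w1 / 2\<close>, nonnegative by
      \<open>nn0\<close>.\<close>
    have "(2 * B + 1) * x \<le> c / 2 * y"
      using False c unfolding R by (simp add: field_simps)
    then have "(2 * B + 1) * x * y \<le> c / 2 * y * y" using y by (rule mult_right_mono)
    moreover have "\<delta> * x * y \<le> 1 * x * y" using \<delta> x y by (intro mult_right_mono) auto
    moreover have "(T * B + T * \<delta> / 2) * y\<^sup>2 \<le> c / 2 * y\<^sup>2"
      using small by (rule mult_right_mono) simp
    moreover have "\<bar>t * \<nu>\<bar> \<le> T * B * y\<^sup>2" "\<bar>t * w2\<bar> \<le> \<delta> * x * y" "\<bar>t\<^sup>2 / 2 * w3\<bar> \<le> T * \<delta> / 2 * y\<^sup>2"
      using bd[of t 0] t by auto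
    ultimately have "0 \<le> \<beta> + 2 * \<gamma> + t * \<nu> + t * w2 + t\<^sup>2 / 2 * w3"
      using \<beta> \<gamma> by (simp add: power2_eq_square algebra_simps)
    moreover have "0 \<le> \<eta> * x\<^sup>2"
    proof -
      have "0 \<le> T * B * R\<^sup>2 + \<delta> * R + T * \<delta> / 2 * R\<^sup>2"
        using \<open>T > 0\<close> B \<delta> \<open>R \<ge> 0\<close> by simp
      then have "0 \<le> \<eta>" using small' by simp
      then show ?thesis by simp
    qed
    ultimately show ?thesis using nn0 le by linarith
  qed
qed

lemma inner_matrix_vector_scaleR:
  fixes A :: "real^'n^'m"
  shows "inner x ((r *\<^sub>R A) *v y) = r * inner x (A *v y)"
  by (simp only: scaleR_matrix_vector_assoc[symmetric] inner_scaleR_right)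

lemma inner_matrix_vector_add:
  fixes A :: "real^'n^'m"
  shows "inner x ((A + B) *v y) = inner x (A *v y) + inner x (B *v y)"
  by (simp only: matrix_vector_mult_add_rdistrib inner_add_right)

text \<open>As \<open>a\<close> lies in the kernel of the symmetric matrix \<open>X\<close>, neither
  the form of \<open>X\<close> at \<open>a\<close> nor the mixed term contributes. Scaling the other
  component by \<open>t\<close> makes every term except the form of \<open>V\<close> at
  \<open>a\<close> of order \<open>t\<^sup>2\<close> or smaller.\<close>

lemma quadratic_form_parabola:
  fixes X V W :: "real^'n^'n"
  assumes sym: "transpose X = X" "transpose V = V" "transpose W = W"
    and a: "X *v a = 0" and t: "t > 0"
  shows "inner (a + t *\<^sub>R b) ((X + t *\<^sub>R V + (t\<^sup>2 / 2) *\<^sub>R W) *v (a + t *\<^sub>R b))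
    = t\<^sup>2 * (inner a (V *v a) / t + inner b (X *v b) + 2 * inner a (V *v b) + t * inner b (V *v b)
        + inner a (W *v a) / 2 + t * inner a (W *v b) + t\<^sup>2 / 2 * inner b (W *v b))"
proof -
  have "inner (a + t *\<^sub>R b) ((X + t *\<^sub>R V + (t\<^sup>2 / 2) *\<^sub>R W) *v (a + t *\<^sub>R b))
    = inner (a + t *\<^sub>R b) (X *v (a + t *\<^sub>R b)) + t * inner (a + t *\<^sub>R b) (V *v (a + t *\<^sub>R b))
      + t\<^sup>2 / 2 * inner (a + t *\<^sub>R b) (W *v (a + t *\<^sub>R b))"
    by (simp only: inner_matrix_vector_add inner_matrix_vector_scaleR)
  also have "\<dots> = t\<^sup>2 * inner b (X *v b) + t * (inner a (V *v a) + 2 * t * inner a (V *v b) + t\<^sup>2 * inner b (V *v b))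
      + t\<^sup>2 / 2 * (inner a (W *v a) + 2 * t * inner a (W *v b) + t\<^sup>2 * inner b (W *v b))"
  proof -
    have "inner a (X *v b) = 0"
      using inner_symmetric_matrix[OF sym(1), of a b] a by simp
    then show ?thesis
      unfolding quadratic_form_add[OF sym(1)] quadratic_form_add[OF sym(2)] quadratic_form_add[OF sym(3)] a
      by simp
  qed
  also have "t\<^sup>2 * \<beta> + t * (\<alpha> + 2 * t * \<gamma> + t\<^sup>2 * \<nu>) + t\<^sup>2 / 2 * (w1 + 2 * t * w2 + t\<^sup>2 * w3)
    = t\<^sup>2 * (\<alpha> / t + \<beta> + 2 * \<gamma> + t * \<nu> + w1 / 2 + t * w2 + t\<^sup>2 / 2 * w3)" for \<alpha> \<beta> \<gamma> \<nu> w1 w2 w3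
    using t by (simp add: distrib_left power2_eq_square)
  finally show ?thesis .
qed

text \<open>A vector splits into a kernel vector \<open>a\<close> of \<open>X\<close> and a vector
  \<open>s *\<^sub>R b\<close> orthogonal to the kernel. Then
  \<open>rescaled_form_lower_bound\<close> carries nonnegativity from \<open>t k\<close> to
  \<open>s\<close> with a loss that the added multiple of the identity pays for.\<close>

lemma psd_parabola_extends:
  fixes X V :: "real^'n^'n" and W :: "nat \<Rightarrow> real^'n^'n"
  assumes X: "X \<in> psd_cone" and t: "\<And>k. 0 < t k" "t \<longlonglongrightarrow> 0"
    and mem: "\<And>k. X + t k *\<^sub>R V + ((t k)\<^sup>2 / 2) *\<^sub>R W k \<in> psd_cone"
    and tW: "(\<lambda>k. t k *\<^sub>R W k) \<longlonglongrightarrow> 0"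
    and symV: "transpose V = V" and symW: "\<And>k. transpose (W k) = W k" and e: "e > 0"
  shows "\<forall>\<^sub>F k in sequentially. \<forall>s. 0 < s \<and> s \<le> t k \<longrightarrow>
    X + s *\<^sub>R V + (s\<^sup>2 / 2) *\<^sub>R (W k + e *\<^sub>R mat 1) \<in> psd_cone"
proof -
  have symX: "transpose X = X" using X by (simp add: psd_cone_def)
  obtain c where c: "c > 0"
    and coer: "\<And>r. (\<And>e. X *v e = 0 \<Longrightarrow> inner r e = 0) \<Longrightarrow> c * (norm r)\<^sup>2 \<le> inner r (X *v r)"
    using psd_coercive_on_kernel_complement[OF X] by blast
  \<comment> \<open>On the kernel of \<open>X\<close> the form at \<open>t k\<close>, divided by
    \<open>t k\<close>, is the form of \<open>V\<close> plus a vanishing term. The sign makes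
    \<open>\<alpha> / t\<close> grow as the parameter decreases.\<close>
  have V_nonneg: "0 \<le> inner a (V *v a)" if a: "X *v a = 0" for a
  proof (rule LIMSEQ_le_const)
    have "(\<lambda>k. inner a ((t k *\<^sub>R W k) *v a)) \<longlonglongrightarrow> 0"
    proof (rule Lim_null_comparison)
      show "\<forall>\<^sub>F k in sequentially. norm (inner a ((t k *\<^sub>R W k) *v a)) \<le> norm (t k *\<^sub>R W k) * norm a * norm a"
        using abs_inner_matrix_vector_le[of a "t k *\<^sub>R W k" a for k] by simp
      show "(\<lambda>k. norm (t k *\<^sub>R W k) * norm a * norm a) \<longlonglongrightarrow> 0"
        using tW by (intro tendsto_mult_left_zero tendsto_norm_zero)
    qed
    then have "(\<lambda>k. inner a (V *v a) + inner a ((t k *\<^sub>R W k) *v a) / 2) \<longlonglongrightarrow> inner a (V *v a) + 0 / 2"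
      by (intro tendsto_intros) auto
    then show "(\<lambda>k. inner a (V *v a) + inner a ((t k *\<^sub>R W k) *v a) / 2) \<longlonglongrightarrow> inner a (V *v a)" by simp
    have "0 \<le> inner a (V *v a) + inner a ((t k *\<^sub>R W k) *v a) / 2" for k
    proof -
      have "0 \<le> inner a ((X + t k *\<^sub>R V + ((t k)\<^sup>2 / 2) *\<^sub>R W k) *v a)"
        using mem[of k] by (simp add: psd_cone_def)
      also have "\<dots> = t k * (inner a (V *v a) + inner a ((t k *\<^sub>R W k) *v a) / 2)"
        by (simp only: inner_matrix_vector_add inner_matrix_vector_scaleR a inner_zero_right power2_eq_square)
          (simp add: distrib_left)
      finally show ?thesis using t(1)[of k] by (simp add: zero_le_mult_iff)
    qed
    then show "\<exists>N. \<forall>k\<ge>N. 0 \<le> inner a (V *v a) + inner a ((t k *\<^sub>R W k) *v a) / 2" by blast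
  qed
  \<comment> \<open>These are the constants of \<open>rescaled_form_lower_bound\<close> for
    \<open>\<eta> = e / 2\<close>; \<open>ev1\<close>, \<open>ev2\<close> and \<open>ev3\<close> are
    its smallness conditions.\<close>
  define B where "B = norm V"
  define R where "R = 2 * (2 * B + 1) / c"
  define \<delta> where "\<delta> k = norm (t k *\<^sub>R W k)" for k
  have \<delta>: "\<delta> \<longlonglongrightarrow> 0" unfolding \<delta>_def using tW by (rule tendsto_norm_zero)
  have "(\<lambda>k. t k * B + t k * \<delta> k / 2) \<longlonglongrightarrow> 0 * B + 0 * 0 / 2"
    by (intro tendsto_intros t(2) \<delta>) auto
  then have ev1: "\<forall>\<^sub>F k in sequentially. t k * B + t k * \<delta> k / 2 < c / 2"
    using c by (intro order_tendstoD(2)) auto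
  have "(\<lambda>k. t k * B * R\<^sup>2 + \<delta> k * R + t k * \<delta> k / 2 * R\<^sup>2) \<longlonglongrightarrow> 0 * B * R\<^sup>2 + 0 * R + 0 * 0 / 2 * R\<^sup>2"
    by (intro tendsto_intros t(2) \<delta>) auto
  then have ev2: "\<forall>\<^sub>F k in sequentially. t k * B * R\<^sup>2 + \<delta> k * R + t k * \<delta> k / 2 * R\<^sup>2 < e / 2"
    using e by (intro order_tendstoD(2)) auto
  have ev3: "\<forall>\<^sub>F k in sequentially. \<delta> k < 1" using \<delta> by (rule order_tendstoD) simp
  from ev1 ev2 ev3 show ?thesis
  proof eventually_elim
    case (elim k)
    show ?case
    proof (intro allI impI)
      fix s assume s: "0 < s \<and> s \<le> t k"
      let ?Z = "X + s *\<^sub>R V + (s\<^sup>2 / 2) *\<^sub>R (W k + e *\<^sub>R mat 1)"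
      have "transpose ?Z = ?Z"
        using symX symV symW[of k] by (simp add: transpose_def vec_eq_iff mat_def eq_commute)
      moreover have "0 \<le> inner u (?Z *v u)" for u
      proof -
        have "subspace {a. X *v a = 0}"
          by (auto simp: subspace_def matrix_vector_right_distrib matrix_vector_mult_scaleR)
        then have span: "span {a. X *v a = 0} = {a. X *v a = 0}" by (simp add: span_eq_iff)
        obtain a r where a: "a \<in> span {a. X *v a = 0}"
          and r: "\<And>w. w \<in> span {a. X *v a = 0} \<Longrightarrow> orthogonal r w" and "u = a + r"
          by (rule orthogonal_subspace_decomp_exists[of "{a. X *v a = 0}" u]) (rule that, auto)
        then have ar: "X *v a = 0" "\<And>w. X *v w = 0 \<Longrightarrow> inner r w = 0" "u = a + r"
          unfolding span orthogonal_def by auto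
        define b where "b = (1 / s) *\<^sub>R r"
        have u: "u = a + s *\<^sub>R b" using s ar(3) by (simp add: b_def)
        have b: "inner b w = 0" if "X *v w = 0" for w
          using ar(2)[OF that] by (simp add: b_def)
        have tk: "t k > 0" by (rule t)
        let ?A = "\<lambda>\<tau> b. inner a (V *v a) / \<tau> + inner b (X *v b) + 2 * inner a (V *v b) + \<tau> * inner b (V *v b)
          + inner a (W k *v a) / 2 + \<tau> * inner a (W k *v b) + \<tau>\<^sup>2 / 2 * inner b (W k *v b)"
        \<comment> \<open>Membership at \<open>t k\<close> is tested at
          \<open>a + t k *\<^sub>R b\<close>, not at \<open>u\<close>, and also with 0 in place of
          \<open>b\<close>; hence the bound for every \<open>b\<close>.\<close>
        have nn: "0 \<le> ?A (t k) b" for b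
        proof -
          have "0 \<le> (t k)\<^sup>2 * ?A (t k) b"
            using mem[of k] unfolding quadratic_form_parabola[OF symX symV symW ar(1) tk, symmetric]
            by (simp add: psd_cone_def)
          then show ?thesis using tk by (simp add: zero_le_mult_iff)
        qed
        have W_le: "t k * \<bar>inner x (W k *v y)\<bar> \<le> \<delta> k * norm x * norm y" for x y
          using abs_inner_matrix_vector_le[of x "t k *\<^sub>R W k" y] tk
          unfolding inner_matrix_vector_scaleR by (simp add: \<delta>_def abs_mult)
        have "- (e / 2) * (norm a)\<^sup>2 \<le> ?A s b"
        proof (rule rescaled_form_lower_bound[where T = "t k" and c = c and B = B and \<delta> = "\<delta> k" and R = R
              and y = "norm b"])
          show "\<bar>inner a (V *v b)\<bar> \<le> B * norm a * norm b"
            unfolding B_def by (rule abs_inner_matrix_vector_le)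
          show "\<bar>inner b (V *v b)\<bar> \<le> B * (norm b)\<^sup>2"
            using abs_inner_matrix_vector_le[of b V b] by (simp add: B_def power2_eq_square mult.assoc)
          show "t k * \<bar>inner a (W k *v b)\<bar> \<le> \<delta> k * norm a * norm b" by (rule W_le)
          show "t k * \<bar>inner b (W k *v b)\<bar> \<le> \<delta> k * (norm b)\<^sup>2"
            using W_le[of b b] by (simp add: power2_eq_square mult.assoc)
          show "0 \<le> inner a (V *v a) / t k + inner a (W k *v a) / 2" using nn[of 0] by simp
        qed (use s c V_nonneg[OF ar(1)] coer[OF b] elim nn[of b] in \<open>auto simp: B_def \<delta>_def R_def\<close>)
        then have "s\<^sup>2 * (- (e / 2) * (norm a)\<^sup>2) \<le> s\<^sup>2 * ?A s b" by (rule mult_left_mono) simp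
        also have "s\<^sup>2 * ?A s b = inner u ((X + s *\<^sub>R V + (s\<^sup>2 / 2) *\<^sub>R W k) *v u)"
          unfolding u using s by (intro quadratic_form_parabola[OF symX symV symW ar(1), symmetric]) auto
        finally have "0 \<le> inner u ((X + s *\<^sub>R V + (s\<^sup>2 / 2) *\<^sub>R W k) *v u) + s\<^sup>2 / 2 * e * (norm a)\<^sup>2"
          by simp
        \<comment> \<open>Orthogonality of \<open>a\<close> and \<open>r\<close> bounds the norm of
          \<open>a\<close> by that of \<open>u\<close>; the identity contributes exactly the
          resulting last term.\<close>
        also have "\<dots> \<le> inner u ((X + s *\<^sub>R V + (s\<^sup>2 / 2) *\<^sub>R W k) *v u) + s\<^sup>2 / 2 * e * (norm u)\<^sup>2"
        proof -
          have "(norm u)\<^sup>2 = (norm a)\<^sup>2 + (norm r)\<^sup>2"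
            using ar(2)[OF ar(1)] by (simp add: ar(3) power2_norm_eq_inner inner_add_left inner_add_right inner_commute)
          then show ?thesis using e by (intro add_left_mono mult_left_mono) auto
        qed
        also have "\<dots> = inner u (?Z *v u)"
          by (simp only: inner_matrix_vector_add inner_matrix_vector_scaleR power2_norm_eq_inner
              matrix_vector_mul_lid distrib_left mult.assoc add.assoc)
        finally show ?thesis .
      qed
      ultimately show "?Z \<in> psd_cone" by (simp add: psd_cone_def)
    qed
  qed
qed

section \<open>Second-order tangent sets\<close>

lemma infdist_approx:
  fixes A :: "'a::metric_space set"
  assumes "A \<noteq> {}" "infdist x A < r"
  obtains a where "a \<in> A" "dist x a < r"
  using assms cINF_less_iff[of A "dist x" r] by (auto simp: infdist_def)

lemma infdist_Times_le:
  fixes A :: "'a::metric_space set" and B :: "'b::metric_space set"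
  assumes "A \<noteq> {}" "B \<noteq> {}"
  shows "infdist (p, q) (A \<times> B) \<le> infdist p A + infdist q B"
proof (rule field_le_epsilon)
  fix e :: real assume e: "e > 0"
  obtain a where a: "a \<in> A" "dist p a < infdist p A + e / 2"
    using infdist_approx[OF assms(1), of p "infdist p A + e / 2"] e by auto
  obtain b where b: "b \<in> B" "dist q b < infdist q B + e / 2"
    using infdist_approx[OF assms(2), of q "infdist q B + e / 2"] e by auto
  have "dist (p, q) (a, b) \<le> dist p a + dist q b"
    by (simp add: dist_Pair_Pair sqrt_sum_squares_le_sum)
  then show "infdist (p, q) (A \<times> B) \<le> infdist p A + infdist q B + e"
    using a b by (intro infdist_le2[of "(a, b)"]) auto
qed

text \<open>Outer tangency provides only some parameter sequence, and two factors may need different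
  ones. Inner tangency of \<open>a\<close> holds along every sequence, so the one belonging to
  \<open>b\<close> serves both.\<close>

lemma outer_tangent2_Times:
  assumes a: "a \<in> inner_tangent2 A y v" and b: "b \<in> outer_tangent2 B z u"
    and ne: "A \<noteq> {}" "B \<noteq> {}"
  shows "(a, b) \<in> outer_tangent2 (A \<times> B) (y, z) (v, u)"
proof -
  obtain t where t: "\<forall>k. 0 < t k" "t \<longlonglongrightarrow> 0"
    and lim: "(\<lambda>k. infdist (z + t k *\<^sub>R u + ((t k)\<^sup>2 / 2) *\<^sub>R b) B / (t k)\<^sup>2) \<longlonglongrightarrow> 0"
    using b by (auto simp: outer_tangent2_def)
  have "filterlim t (at_right 0) sequentially"
    using t by (intro tendsto_imp_filterlim_at_right) auto
  then have "(\<lambda>k. infdist (y + t k *\<^sub>R v + ((t k)\<^sup>2 / 2) *\<^sub>R a) A / (t k)\<^sup>2) \<longlonglongrightarrow> 0"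
    using a unfolding inner_tangent2_def by (auto intro: filterlim_compose)
  from tendsto_add[OF this lim]
  have lim': "(\<lambda>k. infdist (y + t k *\<^sub>R v + ((t k)\<^sup>2 / 2) *\<^sub>R a) A / (t k)\<^sup>2
    + infdist (z + t k *\<^sub>R u + ((t k)\<^sup>2 / 2) *\<^sub>R b) B / (t k)\<^sup>2) \<longlonglongrightarrow> 0" by simp
  have "(\<lambda>k. infdist ((y, z) + t k *\<^sub>R (v, u) + ((t k)\<^sup>2 / 2) *\<^sub>R (a, b)) (A \<times> B) / (t k)\<^sup>2) \<longlonglongrightarrow> 0"
  proof (rule Lim_null_comparison[OF _ lim'], intro always_eventually allI)
    fix k
    show "norm (infdist ((y, z) + t k *\<^sub>R (v, u) + ((t k)\<^sup>2 / 2) *\<^sub>R (a, b)) (A \<times> B) / (t k)\<^sup>2)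
      \<le> infdist (y + t k *\<^sub>R v + ((t k)\<^sup>2 / 2) *\<^sub>R a) A / (t k)\<^sup>2
        + infdist (z + t k *\<^sub>R u + ((t k)\<^sup>2 / 2) *\<^sub>R b) B / (t k)\<^sup>2"
      using infdist_Times_le[OF ne] by (simp add: add_divide_distrib[symmetric] divide_right_mono infdist_nonneg)
  qed
  then show ?thesis using t unfolding outer_tangent2_def by (intro CollectI exI[of _ t]) simp
qed

text \<open>Reparametrise the curve by \<open>t = s - \<alpha> s\<^sup>2 / 2\<close>, so that \<open>t + \<alpha> t\<^sup>2 / 2 = s + o(s\<^sup>2)\<close>.\<close>
lemma outer_tangent2_add_direction:
  assumes "w \<in> outer_tangent2 C y v"
  shows "w + \<alpha> *\<^sub>R v \<in> outer_tangent2 C y v"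
proof -
  obtain s where s: "\<forall>k. 0 < s k" "s \<longlonglongrightarrow> 0"
    and lim: "(\<lambda>k. infdist (y + s k *\<^sub>R v + ((s k)\<^sup>2 / 2) *\<^sub>R w) C / (s k)\<^sup>2) \<longlonglongrightarrow> 0"
    using assms by (auto simp: outer_tangent2_def)
  have s0: "filterlim s (at_right 0) sequentially"
    using s by (intro tendsto_imp_filterlim_at_right) auto
  define f where "f r = r - \<alpha> * r\<^sup>2 / 2" for r :: real
  have "\<forall>\<^sub>F r in at_right 0. 0 < f r"
    unfolding f_def by real_asymp
  from eventually_compose_filterlim[OF this s0] have "\<forall>\<^sub>F k in sequentially. 0 < f (s k)" .
  then obtain N where N: "\<And>k. k \<ge> N \<Longrightarrow> 0 < f (s k)"
    by (auto simp: eventually_sequentially)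
  \<comment> \<open>The difference of the two curves, divided by \<open>(f r)\<^sup>2\<close>, has
    the coefficients of \<open>lim2\<close> at \<open>v\<close> and of \<open>lim3\<close> at
    \<open>w\<close>; \<open>lim1\<close> converts the division by \<open>r\<^sup>2\<close>.\<close>
  have lim1: "((\<lambda>r. r\<^sup>2 / (f r)\<^sup>2) \<longlongrightarrow> 1) (at_right 0)"
    and lim2: "((\<lambda>r. (f r + \<alpha> * (f r)\<^sup>2 / 2 - r) / (f r)\<^sup>2) \<longlongrightarrow> 0) (at_right 0)"
    and lim3: "((\<lambda>r. ((f r)\<^sup>2 / 2 - r\<^sup>2 / 2) / (f r)\<^sup>2) \<longlongrightarrow> 0) (at_right 0)"
    and lim4: "(f \<longlongrightarrow> 0) (at_right 0)"
    unfolding f_def by real_asymp+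
  note lims = lim1[THEN filterlim_compose, OF s0] lim2[THEN filterlim_compose, OF s0]
    lim3[THEN filterlim_compose, OF s0] lim4[THEN filterlim_compose, OF s0]
  let ?g = "\<lambda>k. infdist (y + f (s k) *\<^sub>R v + ((f (s k))\<^sup>2 / 2) *\<^sub>R (w + \<alpha> *\<^sub>R v)) C / (f (s k))\<^sup>2"
  let ?a = "\<lambda>k. infdist (y + s k *\<^sub>R v + ((s k)\<^sup>2 / 2) *\<^sub>R w) C / (s k)\<^sup>2 * ((s k)\<^sup>2 / (f (s k))\<^sup>2)"
  let ?b = "\<lambda>k. (f (s k) + \<alpha> * (f (s k))\<^sup>2 / 2 - s k) / (f (s k))\<^sup>2"
  let ?c = "\<lambda>k. ((f (s k))\<^sup>2 / 2 - (s k)\<^sup>2 / 2) / (f (s k))\<^sup>2"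
  have "(\<lambda>k. ?a k + norm (?b k *\<^sub>R v + ?c k *\<^sub>R w)) \<longlonglongrightarrow> 0 * 1 + norm (0 *\<^sub>R v + 0 *\<^sub>R w)"
    by (intro tendsto_intros lims lim)
  then have bound: "(\<lambda>k. ?a k + norm (?b k *\<^sub>R v + ?c k *\<^sub>R w)) \<longlonglongrightarrow> 0" by simp
  have "?g \<longlonglongrightarrow> 0"
  proof (rule Lim_null_comparison[OF _ bound], rule eventually_sequentiallyI)
    fix k assume "N \<le> k"
    then have fk: "f (s k) > 0" and sk: "s k > 0" using N s by auto
    let ?A = "y + f (s k) *\<^sub>R v + ((f (s k))\<^sup>2 / 2) *\<^sub>R (w + \<alpha> *\<^sub>R v)" and ?B = "y + s k *\<^sub>R v + ((s k)\<^sup>2 / 2) *\<^sub>R w"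
    have "infdist ?A C
      \<le> infdist ?B C
        + dist ?A ?B"
      by (rule infdist_triangle)
    also have "dist ?A ?B = norm (?A - ?B)" by (rule dist_norm)
    also have "?A - ?B = (f (s k))\<^sup>2 *\<^sub>R (?b k *\<^sub>R v + ?c k *\<^sub>R w)"
    proof -
      have "(f (s k))\<^sup>2 * ?b k = f (s k) + \<alpha> * (f (s k))\<^sup>2 / 2 - s k"
        "(f (s k))\<^sup>2 * ?c k = (f (s k))\<^sup>2 / 2 - (s k)\<^sup>2 / 2"
        using fk by simp_all
      then have "(f (s k))\<^sup>2 *\<^sub>R (?b k *\<^sub>R v + ?c k *\<^sub>R w)
        = (f (s k) + \<alpha> * (f (s k))\<^sup>2 / 2 - s k) *\<^sub>R v + ((f (s k))\<^sup>2 / 2 - (s k)\<^sup>2 / 2) *\<^sub>R w"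
        by (simp only: scaleR_add_right scaleR_scaleR)
      then show ?thesis by (simp add: algebra_simps)
    qed
    finally show "norm (?g k) \<le> ?a k + norm (?b k *\<^sub>R v + ?c k *\<^sub>R w)"
      using fk sk by (simp add: infdist_nonneg divide_le_eq distrib_left mult.commute)
  qed
  \<comment> \<open>The tail is taken because the parameters must be positive at every
    index.\<close>
  then have "(\<lambda>k. ?g (k + N)) \<longlonglongrightarrow> 0" "(\<lambda>k. f (s (k + N))) \<longlonglongrightarrow> 0"
    using lims(4) by (auto intro: LIMSEQ_ignore_initial_segment)
  moreover have "\<forall>k. 0 < f (s (k + N))" using N by simp
  ultimately show ?thesis
    unfolding outer_tangent2_def by (intro CollectI exI[of _ "\<lambda>k. f (s (k + N))"]) simp
qed

text \<open>The tangent set contains a whole line in direction \<open>v\<close>, and a linear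
  functional bounded above on a line is constant there. The multiple of \<open>v\<close> is chosen
  to reach the value \<open>s + 1\<close>.\<close>

lemma orthogonal_if_bounded_on_outer_tangent2:
  assumes w: "w \<in> outer_tangent2 C y v" and le: "\<And>w. w \<in> outer_tangent2 C y v \<Longrightarrow> inner m w \<le> s"
  shows "inner m v = 0"
proof (rule ccontr)
  assume ne: "inner m v \<noteq> 0"
  have "inner m w + (s - inner m w + 1) / inner m v * inner m v \<le> s"
    using le[OF outer_tangent2_add_direction[OF w, of "(s - inner m w + 1) / inner m v"]]
    by (simp add: inner_add_right)
  then show False using ne by simp
qed

text \<open>Points of \<open>C\<close> close to the parabola at parameters tending to 0 define
  second-order quotients \<open>u k\<close> in a fixed ball about \<open>w\<close>. The ball is
  compact, and a cluster point of the quotients is a second-order tangent.\<close>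

lemma outer_tangent2_near:
  fixes C :: "'a::euclidean_space set"
  assumes ne: "C \<noteq> {}" and r: "r > 0"
    and ev: "\<forall>\<^sub>F s in at_right 0. infdist (y + s *\<^sub>R v + (s\<^sup>2 / 2) *\<^sub>R w) C \<le> r * s\<^sup>2"
  shows "\<exists>z\<in>outer_tangent2 C y v. dist w z \<le> 4 * r"
proof -
  obtain b where b: "b > 0"
    and le: "\<And>s. 0 < s \<Longrightarrow> s < b \<Longrightarrow> infdist (y + s *\<^sub>R v + (s\<^sup>2 / 2) *\<^sub>R w) C \<le> r * s\<^sup>2"
    using ev unfolding eventually_at_right_field by auto
  \<comment> \<open>Adding 2 keeps even \<open>s 0\<close> strictly below \<open>b\<close>.\<close>
  define s where "s k = b / (real k + 2)" for k :: nat
  have s: "0 < s k" "s k < b" for k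
    using b by (auto simp: s_def field_simps intro: add_pos_nonneg)
  have s0: "s \<longlonglongrightarrow> 0" unfolding s_def by real_asymp
  have "\<exists>p\<in>C. dist (y + s k *\<^sub>R v + ((s k)\<^sup>2 / 2) *\<^sub>R w) p < 2 * r * (s k)\<^sup>2" for k
  proof -
    \<comment> \<open>Doubling makes the bound strict, so a point of \<open>C\<close> realises it.
      The other factor 2 in \<open>4 * r\<close> comes from the half in the parabola.\<close>
    have "0 < r * (s k)\<^sup>2" using r s(1)[of k] by simp
    then have "infdist (y + s k *\<^sub>R v + ((s k)\<^sup>2 / 2) *\<^sub>R w) C < 2 * r * (s k)\<^sup>2"
      using le[OF s, of k] by simp
    then show ?thesis using infdist_approx[OF ne] by metis
  qed
  then obtain p where p: "\<And>k. p k \<in> C"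
    "\<And>k. dist (y + s k *\<^sub>R v + ((s k)\<^sup>2 / 2) *\<^sub>R w) (p k) < 2 * r * (s k)\<^sup>2" by metis
  define u where "u k = (2 / (s k)\<^sup>2) *\<^sub>R (p k - y - s k *\<^sub>R v)" for k
  have pu: "p k = y + s k *\<^sub>R v + ((s k)\<^sup>2 / 2) *\<^sub>R u k" for k
    using s(1)[of k] by (simp add: u_def)
  have dist_eq: "dist (y + s k *\<^sub>R v + ((s k)\<^sup>2 / 2) *\<^sub>R w') (p k) = (s k)\<^sup>2 / 2 * dist w' (u k)" for k w'
    unfolding pu by (simp add: dist_norm scaleR_diff_right[symmetric] abs_mult)
  have "dist w (u k) \<le> 4 * r" for k
    using p(2)[of k] s(1)[of k] unfolding dist_eq by (simp add: field_simps)
  then have "u k \<in> cball w (4 * r)" for k by simp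
  then obtain z \<sigma> where z: "z \<in> cball w (4 * r)" and \<sigma>: "strict_mono (\<sigma> :: nat \<Rightarrow> nat)" "(u \<circ> \<sigma>) \<longlonglongrightarrow> z"
    using compact_cball[of w "4 * r"] unfolding compact_def by metis
  have "(\<lambda>k. infdist (y + s (\<sigma> k) *\<^sub>R v + ((s (\<sigma> k))\<^sup>2 / 2) *\<^sub>R z) C / (s (\<sigma> k))\<^sup>2) \<longlonglongrightarrow> 0"
  proof (rule Lim_null_comparison, intro always_eventually allI)
    fix k
    have "infdist (y + s (\<sigma> k) *\<^sub>R v + ((s (\<sigma> k))\<^sup>2 / 2) *\<^sub>R z) C \<le> (s (\<sigma> k))\<^sup>2 / 2 * dist z (u (\<sigma> k))"
      using infdist_le[OF p(1)] unfolding dist_eq[symmetric] .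
    then show "norm (infdist (y + s (\<sigma> k) *\<^sub>R v + ((s (\<sigma> k))\<^sup>2 / 2) *\<^sub>R z) C / (s (\<sigma> k))\<^sup>2)
      \<le> dist z (u (\<sigma> k)) / 2"
      using s(1)[of "\<sigma> k"] by (simp add: infdist_nonneg field_simps)
  next
    have "(\<lambda>k. dist z ((u \<circ> \<sigma>) k) / 2) \<longlonglongrightarrow> dist z z / 2" by (intro tendsto_intros \<sigma>(2)) auto
    then show "(\<lambda>k. dist z (u (\<sigma> k)) / 2) \<longlonglongrightarrow> 0" by simp
  qed
  moreover have "(\<lambda>k. s (\<sigma> k)) \<longlonglongrightarrow> 0" using LIMSEQ_subseq_LIMSEQ[OF s0 \<sigma>(1)] by (simp add: o_def)
  ultimately have "z \<in> outer_tangent2 C y v" 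
    using s(1) unfolding outer_tangent2_def by (intro CollectI exI[of _ "\<lambda>k. s (\<sigma> k)"]) simp
  then show ?thesis using z by auto
qed

text \<open>After division by \<open>s\<close> the curve tends to \<open>v\<close>, where the
  homogeneous directional inequality is strict if \<open>v\<close> is nonzero. For
  \<open>v = 0\<close> only the norm bound matters.\<close>

lemma eventually_parabola_mem_dir_nbhd:
  fixes v w :: "'a::real_normed_vector"
  assumes "\<rho> > 0" "\<delta> > 0"
  shows "\<forall>\<^sub>F s in at_right 0. s *\<^sub>R v + (s\<^sup>2 / 2) *\<^sub>R w \<in> dir_nbhd \<rho> \<delta> v"
proof -
  have "((\<lambda>s. norm (s *\<^sub>R v + (s\<^sup>2 / 2) *\<^sub>R w)) \<longlongrightarrow> norm (0 *\<^sub>R v + (0\<^sup>2 / 2) *\<^sub>R w)) (at_right 0)"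
    by (intro tendsto_intros) auto
  then have small: "\<forall>\<^sub>F s in at_right 0. norm (s *\<^sub>R v + (s\<^sup>2 / 2) *\<^sub>R w) < \<rho>"
    using assms(1) by (intro order_tendstoD(2)) auto
  show ?thesis
  proof (cases "v = 0")
    case True
    then show ?thesis using small by (auto simp: dir_nbhd_def elim: eventually_mono)
  next
    case False
    let ?q = "\<lambda>s. v + (s / 2) *\<^sub>R w"
    have q: "(?q \<longlongrightarrow> v + (0 / 2) *\<^sub>R w) (at_right 0)" by (intro tendsto_intros) auto
    then have q: "(?q \<longlongrightarrow> v) (at_right 0)" by simp
    have "((\<lambda>s. \<delta> * norm (?q s) * norm v - norm (norm v *\<^sub>R ?q s - norm (?q s) *\<^sub>R v))
        \<longlongrightarrow> \<delta> * norm v * norm v - norm (norm v *\<^sub>R v - norm v *\<^sub>R v)) (at_right 0)"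
      by (intro tendsto_intros q)
    then have "\<forall>\<^sub>F s in at_right 0. 0 < \<delta> * norm (?q s) * norm v - norm (norm v *\<^sub>R ?q s - norm (?q s) *\<^sub>R v)"
      by (rule order_tendstoD(1)) (use False assms(2) in simp)
    then show ?thesis using small eventually_at_right_less
    proof eventually_elim
      case (elim s)
      have eq: "s *\<^sub>R v + (s\<^sup>2 / 2) *\<^sub>R w = s *\<^sub>R ?q s" by (simp add: power2_eq_square scaleR_add_right)
      have "norm v *\<^sub>R (s *\<^sub>R ?q s) - norm (s *\<^sub>R ?q s) *\<^sub>R v = s *\<^sub>R (norm v *\<^sub>R ?q s - norm (?q s) *\<^sub>R v)"
        using elim(3) by (simp add: scaleR_diff_right mult.commute)
      then have "norm (norm v *\<^sub>R (s *\<^sub>R ?q s) - norm (s *\<^sub>R ?q s) *\<^sub>R v)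
          = s * norm (norm v *\<^sub>R ?q s - norm (?q s) *\<^sub>R v)"
        using elim(3) by simp
      also have "\<dots> \<le> s * (\<delta> * norm (?q s) * norm v)"
        using elim(1,3) by (intro mult_left_mono) auto
      also have "\<dots> = \<delta> * norm (s *\<^sub>R ?q s) * norm v" using elim(3) by simp
      finally show ?case using elim(2) unfolding dir_nbhd_def eq by auto
    qed
  qed
qed

section \<open>Parabolas in the complementarity set\<close>

text \<open>First-order quotients lie in the closed set \<open>S\<close> and converge to
  \<open>v\<close>; then \<open>w k\<close> is a combination of members. It supplies the symmetry of
  all matrices involved.\<close>

lemma subspace_parabola_mem:
  fixes S :: "'a::euclidean_space set"
  assumes S: "subspace S" and y: "y \<in> S" and t: "\<And>k. 0 < t k"
    and mem: "\<And>k. y + t k *\<^sub>R v + ((t k)\<^sup>2 / 2) *\<^sub>R w k \<in> S"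
    and tw: "(\<lambda>k. t k *\<^sub>R w k) \<longlonglongrightarrow> 0"
  shows "v \<in> S" "w k \<in> S"
proof -
  have *: "(1 / t k) *\<^sub>R ((y + t k *\<^sub>R v + ((t k)\<^sup>2 / 2) *\<^sub>R w k) - y) \<in> S" for k
    by (intro subspace_mul[OF S] subspace_diff[OF S] mem y)
  have memv: "v + (1 / 2) *\<^sub>R (t k *\<^sub>R w k) \<in> S" for k
    using *[of k] t[of k] by (simp add: scaleR_add_right power2_eq_square)
  have "(\<lambda>k. v + (1 / 2) *\<^sub>R (t k *\<^sub>R w k)) \<longlonglongrightarrow> v + (1 / 2) *\<^sub>R 0"
    by (intro tendsto_intros tw)
  from closed_sequentially[OF closed_subspace[OF S] memv this] show v: "v \<in> S" by simp
  have "(2 / (t k)\<^sup>2) *\<^sub>R ((y + t k *\<^sub>R v + ((t k)\<^sup>2 / 2) *\<^sub>R w k) - y - t k *\<^sub>R v) \<in> S"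
    by (intro subspace_mul[OF S] subspace_diff[OF S] mem y v)
  then show "w k \<in> S" using t[of k] by simp
qed

lemma inner_parabola:
  "inner (X + s *\<^sub>R V + (s\<^sup>2 / 2) *\<^sub>R P) (Y + s *\<^sub>R U + (s\<^sup>2 / 2) *\<^sub>R Q)
    = inner X Y + s * (inner X U + inner V Y) + s\<^sup>2 * (inner V U + (inner X Q + inner P Y) / 2)
      + s * s\<^sup>2 / 2 * (inner V Q + inner P U) + s\<^sup>2 * s\<^sup>2 / 4 * inner P Q"
  by (simp add: inner_add_left inner_add_right power2_eq_square distrib_left add_divide_distrib)

lemma infdist_H_map_H_set_le:
  fixes X Y P Q :: "real^'n^'n"
  assumes "X + P \<in> psd_cone" "Y + Q \<in> nsd_cone" "0 \<le> inner X Y + r" "0 \<le> r"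
  shows "infdist (H_map (X, Y)) H_set \<le> norm P + norm Q + r"
proof (rule infdist_le2)
  show "(X + P, Y + Q, inner X Y + r) \<in> H_set" using assms by (simp add: H_set_def)
  have "dist (H_map (X, Y)) (X + P, Y + Q, inner X Y + r)
    \<le> dist X (X + P) + (dist Y (Y + Q) + dist (inner X Y) (inner X Y + r))"
    unfolding H_map_def fst_conv snd_conv dist_Pair_Pair[of X]
    by (rule order_trans[OF sqrt_sum_squares_le_sum])
      (auto simp: dist_Pair_Pair intro!: add_left_mono sqrt_sum_squares_le_sum)
  then show "dist (H_map (X, Y)) (X + P, Y + Q, inner X Y + r) \<le> norm P + norm Q + r"
    using assms(4) by (simp add: dist_norm)
qed

text \<open>The vanishing inner product is expanded in powers of \<open>t k\<close>, with
  coefficients that may be unbounded. Dividing once by \<open>t k\<close> and passing to the limit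
  gives the first claim; a second division leaves the wanted term equal to minus a null
  sequence.\<close>

lemma complementarity_term_tendsto_0:
  fixes X Y V U :: "'a::real_inner"
  assumes t: "\<And>k. 0 < t k" "t \<longlonglongrightarrow> 0" and XY: "inner X Y = 0"
    and orth: "\<And>k. inner (X + t k *\<^sub>R V + ((t k)\<^sup>2 / 2) *\<^sub>R P k) (Y + t k *\<^sub>R U + ((t k)\<^sup>2 / 2) *\<^sub>R Q k) = 0"
    and tP: "(\<lambda>k. t k *\<^sub>R P k) \<longlonglongrightarrow> 0" and tQ: "(\<lambda>k. t k *\<^sub>R Q k) \<longlonglongrightarrow> 0"
  shows "inner X U + inner V Y = 0"
    and "(\<lambda>k. inner V U + (inner X (Q k) + inner (P k) Y) / 2) \<longlonglongrightarrow> 0"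
proof -
  let ?l = "inner X U + inner V Y"
  let ?a = "\<lambda>k. inner V U + (inner X (Q k) + inner (P k) Y) / 2"
  let ?r = "\<lambda>k. (inner V (t k *\<^sub>R Q k) + inner (t k *\<^sub>R P k) U) / 2 + inner (t k *\<^sub>R P k) (t k *\<^sub>R Q k) / 4"
  have "(\<lambda>k. (inner V (B k) + inner (A k) U) / 2 + inner (A k) (B k) / 4) \<longlonglongrightarrow> 0"
    if "A \<longlonglongrightarrow> 0" "B \<longlonglongrightarrow> 0" for A B :: "nat \<Rightarrow> 'a"
    using that by (auto intro!: tendsto_eq_intros)
  from this[OF tP tQ] have r: "?r \<longlonglongrightarrow> 0" .
  have eq: "?l + t k * (?a k + ?r k) = 0" for k
  proof -
    have "t k * (?l + t k * (?a k + ?r k)) = 0"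
      using orth[of k] unfolding inner_parabola XY by (simp add: power2_eq_square algebra_simps)
    then show ?thesis using t(1)[of k] by simp
  qed
  let ?b = "\<lambda>k. t k * inner V U + (inner X (t k *\<^sub>R Q k) + inner (t k *\<^sub>R P k) Y) / 2 + t k * ?r k"
  have "(\<lambda>k. t k * inner V U + (inner X (B k) + inner (A k) Y) / 2 + t k * R k) \<longlonglongrightarrow> 0"
    if "A \<longlonglongrightarrow> 0" "B \<longlonglongrightarrow> 0" "R \<longlonglongrightarrow> 0" for A B :: "nat \<Rightarrow> 'a" and R
    using that t(2) by (auto intro!: tendsto_eq_intros)
  from this[OF tP tQ r] have "?b \<longlonglongrightarrow> 0" .
  moreover have "?b = (\<lambda>k. - ?l)"
  proof
    fix k show "?b k = - ?l" using eq[of k] by (simp add: distrib_left add_divide_distrib)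
  qed
  ultimately show l: "?l = 0" by (simp add: LIMSEQ_const_iff)
  have "?a = (\<lambda>k. - ?r k)"
  proof
    fix k show "?a k = - ?r k" using eq[of k] l t(1)[of k] by (simp add: add_eq_0_iff)
  qed
  then show "?a \<longlonglongrightarrow> 0" using tendsto_minus[OF r] by simp
qed

lemma Omega_set_parabola_near_tangent2:
  fixes X Y V U :: "real^'n^'n" and W :: "nat \<Rightarrow> (real^'n^'n) \<times> (real^'n^'n)"
  assumes t: "\<And>k. 0 < t k" "t \<longlonglongrightarrow> 0" and XY: "(X, Y) \<in> Omega_set"
    and mem: "\<And>k. (X, Y) + t k *\<^sub>R (V, U) + ((t k)\<^sup>2 / 2) *\<^sub>R W k \<in> Omega_set"
    and tW: "(\<lambda>k. t k *\<^sub>R W k) \<longlonglongrightarrow> 0"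
    and subreg: "dir_metric_subregular (sym_mats \<times> sym_mats) H_map H_set (X, Y) (V, U)"
    and e: "e > 0"
  shows "\<forall>\<^sub>F k in sequentially. \<exists>z\<in>outer_tangent2 Omega_set (X, Y) (V, U). dist (W k) z < e"
proof -
  define P Q where "P k = fst (W k)" and "Q k = snd (W k)" for k
  have W: "W k = (P k, Q k)" for k by (simp add: P_def Q_def)
  have XY': "X \<in> psd_cone" "- Y \<in> psd_cone" "inner X Y = 0"
    using XY by (auto simp: Omega_set_def)
  have memX: "X + t k *\<^sub>R V + ((t k)\<^sup>2 / 2) *\<^sub>R P k \<in> psd_cone"
    and memY: "Y + t k *\<^sub>R U + ((t k)\<^sup>2 / 2) *\<^sub>R Q k \<in> nsd_cone"
    and orth: "inner (X + t k *\<^sub>R V + ((t k)\<^sup>2 / 2) *\<^sub>R P k) (Y + t k *\<^sub>R U + ((t k)\<^sup>2 / 2) *\<^sub>R Q k) = 0" for k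
    using mem[of k] by (auto simp: W Omega_set_def)
  \<comment> \<open>Negation brings the second component under
    \<open>psd_parabola_extends\<close>.\<close>
  have memY': "- Y + t k *\<^sub>R - U + ((t k)\<^sup>2 / 2) *\<^sub>R - Q k \<in> psd_cone" for k
  proof -
    have "- Y + t k *\<^sub>R - U + ((t k)\<^sup>2 / 2) *\<^sub>R - Q k = - (Y + t k *\<^sub>R U + ((t k)\<^sup>2 / 2) *\<^sub>R Q k)" by simp
    then show ?thesis using memY[of k] by (simp only: uminus_mem_psd_cone)
  qed
  have tP: "(\<lambda>k. t k *\<^sub>R P k) \<longlonglongrightarrow> 0" and tQ: "(\<lambda>k. t k *\<^sub>R Q k) \<longlonglongrightarrow> 0"
    using tendsto_fst[OF tW] tendsto_snd[OF tW] by (auto simp: P_def Q_def)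
  then have tQ': "(\<lambda>k. t k *\<^sub>R - Q k) \<longlonglongrightarrow> 0" using tendsto_minus[OF tQ] by simp
  have Omega_sym: "Omega_set \<subseteq> sym_mats \<times> (sym_mats :: (real^'n^'n) set)"
    unfolding Omega_set_eq_H_map_vimage[symmetric] by blast
  have sub: "subspace (sym_mats \<times> (sym_mats :: (real^'n^'n) set))"
    by (intro subspace_Times subspace_sym_mats)
  note sym = subspace_parabola_mem[OF sub subsetD[OF Omega_sym XY] t(1) subsetD[OF Omega_sym mem] tW]
  have symP: "transpose (P k) = P k" and symQ: "transpose (- Q k) = - Q k" for k
    using sym(2)[of k] by (auto simp: W sym_mats_def transpose_def vec_eq_iff)
  have symV: "transpose V = V" and symU: "transpose (- U) = - U"
    using sym(1) by (auto simp: sym_mats_def transpose_def vec_eq_iff)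
  obtain \<kappa> \<rho> \<delta> where pos: "\<kappa> > 0" "\<rho> > 0" "\<delta> > 0"
    and "\<forall>w\<in>dir_nbhd \<rho> \<delta> (V, U). (X, Y) + w \<in> sym_mats \<times> sym_mats \<longrightarrow>
      infdist ((X, Y) + w) Omega_set \<le> \<kappa> * infdist (H_map ((X, Y) + w)) H_set"
    using subreg unfolding dir_metric_subregular_def Omega_set_eq_H_map_vimage
    by (elim exE conjE) (rule that)
  note sr = this(4)[rule_format]
  \<comment> \<open>The distance to \<open>H_set\<close> will be at most
    \<open>\<epsilon> * n * s\<^sup>2\<close>: two shifts by
    \<open>s\<^sup>2 / 2 * \<epsilon>\<close> times the identity, and
    \<open>2 * \<epsilon> * s\<^sup>2\<close> for the trace product. The 8 in
    \<open>\<epsilon>\<close> makes the final distance \<open>e / 2\<close>.\<close>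
  define n where "n = norm (mat 1 :: real^'n^'n) + 2"
  have n: "n > 0" by (simp add: n_def add_nonneg_pos)
  define \<epsilon> where "\<epsilon> = e / (8 * \<kappa> * n)"
  have \<epsilon>: "\<epsilon> > 0" using pos e n by (simp add: \<epsilon>_def)
  let ?a = "\<lambda>k. inner V U + (inner X (Q k) + inner (P k) Y) / 2"
  note compl = complementarity_term_tendsto_0[OF t XY'(3) orth tP tQ]
  have "\<forall>\<^sub>F k in sequentially. - \<epsilon> < ?a k"
    using order_tendstoD(1)[OF compl(2), of "- \<epsilon>"] \<epsilon> by simp
  with psd_parabola_extends[OF XY'(1) t memX tP symV symP \<epsilon>]
    psd_parabola_extends[OF XY'(2) t memY' tQ' symU symQ \<epsilon>]
  show ?thesis
  proof eventually_elim
    case (elim k)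
    let ?X = "\<lambda>s. X + s *\<^sub>R V + (s\<^sup>2 / 2) *\<^sub>R P k" and ?Y = "\<lambda>s. Y + s *\<^sub>R U + (s\<^sup>2 / 2) *\<^sub>R Q k"
    \<comment> \<open>By \<open>compl(1)\<close> the trace product of the two curves is
      \<open>s\<^sup>2 * (?a k + ?r s)\<close>. The first summand exceeds
      \<open>- \<epsilon>\<close> because \<open>k\<close> is large, the second because
      \<open>s\<close> is small for this fixed \<open>k\<close>.\<close>
    let ?r = "\<lambda>s. s / 2 * (inner V (Q k) + inner (P k) U) + s\<^sup>2 / 4 * inner (P k) (Q k)"
    have "(?r \<longlongrightarrow> 0 / 2 * (inner V (Q k) + inner (P k) U) + 0\<^sup>2 / 4 * inner (P k) (Q k)) (at_right 0)"
      by (intro tendsto_intros) auto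
    then have "\<forall>\<^sub>F s in at_right 0. - \<epsilon> < ?r s"
      by (rule order_tendstoD(1)) (use \<epsilon> in simp)
    moreover have "\<forall>\<^sub>F s in at_right 0. s < t k"
      using t(1)[of k] by (intro order_tendstoD(2)[OF tendsto_ident_at])
    ultimately have "\<forall>\<^sub>F s in at_right 0.
      infdist ((X, Y) + s *\<^sub>R (V, U) + (s\<^sup>2 / 2) *\<^sub>R W k) Omega_set \<le> \<kappa> * \<epsilon> * n * s\<^sup>2"
      using eventually_parabola_mem_dir_nbhd[OF pos(2,3), of "(V, U)" "W k"] eventually_at_right_less
    proof eventually_elim
      case (elim s)
      let ?w = "s *\<^sub>R (V, U) + (s\<^sup>2 / 2) *\<^sub>R W k"
      have w: "(X, Y) + ?w = (?X s, ?Y s)" by (simp add: W)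
      have "(X, Y) + ?w \<in> sym_mats \<times> sym_mats"
        by (intro subspace_add[OF sub] subspace_mul[OF sub] sym subsetD[OF Omega_sym XY])
      from sr[OF elim(3) this]
      have "infdist ((X, Y) + ?w) Omega_set \<le> \<kappa> * infdist (H_map (?X s, ?Y s)) H_set"
        unfolding w .
      also have "infdist (H_map (?X s, ?Y s)) H_set
        \<le> norm ((s\<^sup>2 / 2 * \<epsilon>) *\<^sub>R (mat 1 :: real^'n^'n)) + norm (- (s\<^sup>2 / 2 * \<epsilon>) *\<^sub>R (mat 1 :: real^'n^'n)) + 2 * \<epsilon> * s\<^sup>2"
      proof (rule infdist_H_map_H_set_le)
        show "?X s + (s\<^sup>2 / 2 * \<epsilon>) *\<^sub>R mat 1 \<in> psd_cone"
          using \<open>\<forall>s. 0 < s \<and> s \<le> t k \<longrightarrow> X + s *\<^sub>R V + (s\<^sup>2 / 2) *\<^sub>R (P k + \<epsilon> *\<^sub>R mat 1) \<in> psd_cone\<close> elim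
          by (simp add: scaleR_add_right add.assoc)
        have "- Y + s *\<^sub>R - U + (s\<^sup>2 / 2) *\<^sub>R (- Q k + \<epsilon> *\<^sub>R mat 1) \<in> psd_cone"
          using \<open>\<forall>s. 0 < s \<and> s \<le> t k \<longrightarrow> - Y + s *\<^sub>R - U + (s\<^sup>2 / 2) *\<^sub>R (- Q k + \<epsilon> *\<^sub>R mat 1) \<in> psd_cone\<close> elim
          by simp
        also have "- Y + s *\<^sub>R - U + (s\<^sup>2 / 2) *\<^sub>R (- Q k + \<epsilon> *\<^sub>R mat 1) = - (?Y s + - (s\<^sup>2 / 2 * \<epsilon>) *\<^sub>R mat 1)"
          by (simp add: scaleR_diff_right)
        finally show "?Y s + - (s\<^sup>2 / 2 * \<epsilon>) *\<^sub>R mat 1 \<in> nsd_cone" by (simp only: uminus_mem_psd_cone)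
        have "inner (?X s) (?Y s) = s\<^sup>2 * (?a k + ?r s)"
          unfolding inner_parabola XY'(3) compl(1) by (simp add: power2_eq_square algebra_simps)
        moreover have "s\<^sup>2 * (- 2 * \<epsilon>) \<le> s\<^sup>2 * (?a k + ?r s)"
          using \<open>- \<epsilon> < ?a k\<close> elim(1) by (intro mult_left_mono) auto
        moreover have "s\<^sup>2 * (- 2 * \<epsilon>) = - (2 * \<epsilon> * s\<^sup>2)" by simp
        ultimately show "0 \<le> inner (?X s) (?Y s) + 2 * \<epsilon> * s\<^sup>2" by linarith
        show "0 \<le> 2 * \<epsilon> * s\<^sup>2" using \<epsilon> by simp
      qed
      also have "\<dots> = \<epsilon> * n * s\<^sup>2" using \<epsilon> by (simp add: n_def abs_mult algebra_simps)
      finally show ?case using pos(1) by (simp only: add.assoc mult.assoc mult_left_mono less_imp_le)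
    qed
    then have "\<exists>z\<in>outer_tangent2 Omega_set (X, Y) (V, U). dist (W k) z \<le> 4 * (\<kappa> * \<epsilon> * n)"
      using XY pos \<epsilon> n by (intro outer_tangent2_near) auto
    then obtain z where "z \<in> outer_tangent2 Omega_set (X, Y) (V, U)" "dist (W k) z \<le> 4 * (\<kappa> * \<epsilon> * n)" ..
    moreover have "4 * (\<kappa> * \<epsilon> * n) = e / 2"
      using pos n by (simp add: \<epsilon>_def)
    ultimately show ?case using e by (intro bexI[of _ z]) auto
  qed
qed

section \<open>Second-order expansions and quadratic growth\<close>

text \<open>Differentiability of \<open>Df\<close> is assumed at \<open>a\<close> only, so the mean
  value inequality is applied to the remainder along the segment.\<close>

lemma second_order_taylor_bound:
  fixes f :: "'a::real_normed_vector \<Rightarrow> 'b::real_normed_vector" and Df :: "'a \<Rightarrow> 'a \<Rightarrow>\<^sub>L 'b"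
  assumes df: "\<And>x. (f has_derivative blinfun_apply (Df x)) (at x)"
    and d2f: "(Df has_derivative blinfun_apply D2) (at a)"
    and \<epsilon>: "\<epsilon> > 0"
  shows "\<exists>r>0. \<forall>u. norm u < r \<longrightarrow>
    norm (f (a + u) - f a - Df a u - (1 / 2) *\<^sub>R blinfun_apply (blinfun_apply D2 u) u) \<le> \<epsilon> * (norm u)\<^sup>2"
proof -
  obtain r where r: "r > 0"
    and near: "\<And>y. norm (y - a) < r \<Longrightarrow> norm (Df y - Df a - D2 (y - a)) \<le> \<epsilon> * norm (y - a)"
    using d2f[unfolded has_derivative_at_alt, THEN conjunct2, rule_format, OF \<epsilon>] by blast
  show ?thesis
  proof (intro exI[of _ r] conjI allI impI r)
    fix u :: 'a assume u: "norm u < r"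
    \<comment> \<open>The remainder is \<open>g 1 - g 0\<close>, and \<open>g'\<close> is the
      first-order remainder of \<open>Df\<close>, at most \<open>\<epsilon> * norm u\<close>,
      applied to \<open>u\<close>.\<close>
    define g where "g s = f (a + s *\<^sub>R u) - s *\<^sub>R Df a u - (s\<^sup>2 / 2) *\<^sub>R blinfun_apply (D2 u) u" for s :: real
    define g' where "g' s = blinfun_apply (Df (a + s *\<^sub>R u) - Df a - D2 (s *\<^sub>R u)) u" for s :: real
    have "(g has_derivative (\<lambda>h. h *\<^sub>R g' s)) (at s within {0..1})" for s
    proof -
      have "((\<lambda>s. a + s *\<^sub>R u) has_derivative (\<lambda>h. h *\<^sub>R u)) (at s within {0..1})"
        by (auto intro!: derivative_eq_intros)
      from has_derivative_compose[OF this df]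
      have "((\<lambda>s. f (a + s *\<^sub>R u)) has_derivative (\<lambda>h. Df (a + s *\<^sub>R u) (h *\<^sub>R u))) (at s within {0..1})" .
      then show ?thesis
        unfolding g_def g'_def
        by (auto intro!: derivative_eq_intros
            simp: blinfun.bilinear_simps algebra_simps)
    qed
    moreover have "onorm (\<lambda>h. h *\<^sub>R g' s) \<le> \<epsilon> * (norm u)\<^sup>2" if "s \<in> {0..1}" for s
    proof (rule onorm_bound)
      have "norm (s *\<^sub>R u) \<le> norm u" using that by (simp add: mult_left_le_one_le)
      then have "norm (Df (a + s *\<^sub>R u) - Df a - D2 (s *\<^sub>R u)) \<le> \<epsilon> * norm u"
        using near[of "a + s *\<^sub>R u"] u \<epsilon> by (auto intro: order_trans mult_left_mono)
      then have "norm (Df (a + s *\<^sub>R u) - Df a - D2 (s *\<^sub>R u)) * norm u \<le> \<epsilon> * norm u * norm u"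
        by (rule mult_right_mono) simp
      then have "norm (g' s) \<le> \<epsilon> * (norm u)\<^sup>2"
        using norm_blinfun[of "Df (a + s *\<^sub>R u) - Df a - D2 (s *\<^sub>R u)" u]
        unfolding g'_def power2_eq_square by (simp add: mult.assoc)
      then show "norm (h *\<^sub>R g' s) \<le> \<epsilon> * (norm u)\<^sup>2 * norm h" for h
        by (simp add: mult.commute mult_left_mono)
    qed (use \<epsilon> in simp)
    ultimately have "norm (g 1 - g 0) \<le> \<epsilon> * (norm u)\<^sup>2 * norm (1 - 0 :: real)"
      by (intro differentiable_bound[of "{0..1}"]) auto
    then show "norm (f (a + u) - f a - Df a u - (1 / 2) *\<^sub>R blinfun_apply (blinfun_apply D2 u) u) \<le> \<epsilon> * (norm u)\<^sup>2"
      by (simp add: g_def algebra_simps)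
  qed
qed

lemma second_order_quotient_tendsto:
  fixes f :: "'a::real_normed_vector \<Rightarrow> 'b::real_normed_vector" and Df :: "'a \<Rightarrow> 'a \<Rightarrow>\<^sub>L 'b"
  assumes df: "\<And>x. (f has_derivative blinfun_apply (Df x)) (at x)"
    and d2f: "(Df has_derivative blinfun_apply D2) (at a)"
    and x: "x \<longlonglongrightarrow> a" "\<And>k. x k \<noteq> a" and d: "(\<lambda>k. (1 / norm (x k - a)) *\<^sub>R (x k - a)) \<longlonglongrightarrow> d"
  shows "(\<lambda>k. (2 / (norm (x k - a))\<^sup>2) *\<^sub>R (f (x k) - f a - Df a (x k - a)))
    \<longlonglongrightarrow> blinfun_apply (blinfun_apply D2 d) d"
proof -
  let ?d = "\<lambda>k. (1 / norm (x k - a)) *\<^sub>R (x k - a)"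
  let ?e = "\<lambda>k. (2 / (norm (x k - a))\<^sup>2) *\<^sub>R (f (x k) - f a - Df a (x k - a))"
  have "(\<lambda>k. ?e k - blinfun_apply (D2 (?d k)) (?d k)) \<longlonglongrightarrow> 0"
  proof (rule tendstoI)
    fix e :: real assume e: "e > 0"
    obtain r where r: "r > 0"
      and bound: "\<And>u. norm u < r \<Longrightarrow>
        norm (f (a + u) - f a - Df a u - (1 / 2) *\<^sub>R blinfun_apply (D2 u) u) \<le> e / 4 * (norm u)\<^sup>2"
      using second_order_taylor_bound[OF df d2f, of "e / 4"] e by auto
    have "\<forall>\<^sub>F k in sequentially. dist (x k) a < r" using x(1) r by (rule tendstoD)
    then show "\<forall>\<^sub>F k in sequentially. dist (?e k - blinfun_apply (D2 (?d k)) (?d k)) 0 < e"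
    proof eventually_elim
      case (elim k)
      define u where "u = x k - a"
      have u: "u \<noteq> 0" "x k = a + u" using x(2)[of k] by (auto simp: u_def)
      have "?e k - blinfun_apply (D2 (?d k)) (?d k)
        = (2 / (norm u)\<^sup>2) *\<^sub>R (f (a + u) - f a - Df a u - (1 / 2) *\<^sub>R blinfun_apply (D2 u) u)"
        unfolding u(2) by (simp add: blinfun.bilinear_simps scaleR_diff_right power2_eq_square)
      then have "norm (?e k - blinfun_apply (D2 (?d k)) (?d k))
        = 2 / (norm u)\<^sup>2 * norm (f (a + u) - f a - Df a u - (1 / 2) *\<^sub>R blinfun_apply (D2 u) u)"
        by simp
      also have "\<dots> \<le> 2 / (norm u)\<^sup>2 * (e / 4 * (norm u)\<^sup>2)"
        using bound[of u] elim by (intro mult_left_mono) (auto simp: u_def dist_norm)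
      also have "\<dots> < e" using u e by simp
      finally show ?case by simp
    qed
  qed
  moreover have "(\<lambda>k. blinfun_apply (D2 (?d k)) (?d k)) \<longlonglongrightarrow> blinfun_apply (D2 d) d"
    by (intro tendsto_intros d)
  ultimately show ?thesis using tendsto_add by fastforce
qed

lemma first_order_quotient_tendsto:
  fixes f :: "'a::real_normed_vector \<Rightarrow> 'b::real_normed_vector" and Df :: "'a \<Rightarrow> 'a \<Rightarrow>\<^sub>L 'b"
  assumes df: "\<And>x. (f has_derivative blinfun_apply (Df x)) (at x)"
    and d2f: "(Df has_derivative blinfun_apply D2) (at a)"
    and x: "x \<longlonglongrightarrow> a" "\<And>k. x k \<noteq> a" and d: "(\<lambda>k. (1 / norm (x k - a)) *\<^sub>R (x k - a)) \<longlonglongrightarrow> d"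
  shows "(\<lambda>k. (1 / norm (x k - a)) *\<^sub>R (f (x k) - f a)) \<longlonglongrightarrow> Df a d"
proof -
  let ?d = "\<lambda>k. (1 / norm (x k - a)) *\<^sub>R (x k - a)"
  let ?e = "\<lambda>k. (2 / (norm (x k - a))\<^sup>2) *\<^sub>R (f (x k) - f a - Df a (x k - a))"
  have "(\<lambda>k. norm (x k - a)) \<longlonglongrightarrow> 0"
    using x(1) by (simp add: LIM_zero tendsto_norm_zero)
  then have "(\<lambda>k. Df a (?d k) + (norm (x k - a) / 2) *\<^sub>R ?e k)
      \<longlonglongrightarrow> Df a d + (0 / 2) *\<^sub>R blinfun_apply (blinfun_apply D2 d) d"
    by (intro tendsto_intros d second_order_quotient_tendsto[OF assms]) auto
  moreover have "Df a (?d k) + (norm (x k - a) / 2) *\<^sub>R ?e k = (1 / norm (x k - a)) *\<^sub>R (f (x k) - f a)" for k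
    using x(2)[of k] by (simp add: blinfun.bilinear_simps scaleR_diff_right power2_eq_square)
  ultimately show ?thesis by simp
qed

section \<open>Failure of quadratic growth and the contradiction\<close>

text \<open>Both failing constants are \<open>inverse (real (Suc k))\<close>; the strict inequality
  excludes \<open>x k = a\<close>, and compactness of the unit sphere gives \<open>d\<close> along a
  subsequence.\<close>

lemma no_quadratic_growth_sequence:
  fixes f :: "'a::euclidean_space \<Rightarrow> real"
  assumes "\<not> (\<exists>\<kappa>>0. \<exists>\<delta>>0. \<forall>x. P x \<and> norm (x - a) \<le> \<delta> \<longrightarrow> f x \<ge> f a + \<kappa> * (norm (x - a))\<^sup>2)"
  obtains x e d where "\<And>k. P (x k)" "x \<longlonglongrightarrow> a" "\<And>k. x k \<noteq> a" "e \<longlonglongrightarrow> 0"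
    "\<And>k. f (x k) < f a + e k * (norm (x k - a))\<^sup>2"
    "(\<lambda>k. (1 / norm (x k - a)) *\<^sub>R (x k - a)) \<longlonglongrightarrow> d" "norm d = 1"
proof -
  have "\<exists>x. P x \<and> norm (x - a) \<le> inverse (real (Suc k)) \<and> f x < f a + inverse (real (Suc k)) * (norm (x - a))\<^sup>2" for k
    using assms by (metis not_le inverse_positive_iff_positive of_nat_0_less_iff zero_less_Suc)
  then obtain x where x: "\<And>k. P (x k)" "\<And>k. norm (x k - a) \<le> inverse (real (Suc k))"
    "\<And>k. f (x k) < f a + inverse (real (Suc k)) * (norm (x k - a))\<^sup>2" by metis
  have ne: "x k \<noteq> a" for k using x(3)[of k] by auto
  have "x \<longlonglongrightarrow> a"
    using x(2) by (intro LIM_zero_cancel[OF Lim_null_comparison[OF _ LIMSEQ_inverse_real_of_nat]]) auto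
  have "\<forall>k. (1 / norm (x k - a)) *\<^sub>R (x k - a) \<in> sphere 0 1" using ne by simp
  then obtain d \<sigma> where d: "d \<in> sphere (0 :: 'a) 1" and \<sigma>: "strict_mono (\<sigma> :: nat \<Rightarrow> nat)"
    and lim: "((\<lambda>k. (1 / norm (x k - a)) *\<^sub>R (x k - a)) \<circ> \<sigma>) \<longlonglongrightarrow> d"
    by (rule seq_compactE[OF compact_imp_seq_compact[OF compact_sphere]])
  show ?thesis
  proof (rule that[of "x \<circ> \<sigma>" "(\<lambda>k. inverse (real (Suc k))) \<circ> \<sigma>" d])
    show "(x \<circ> \<sigma>) \<longlonglongrightarrow> a" using LIMSEQ_subseq_LIMSEQ[OF \<open>x \<longlonglongrightarrow> a\<close> \<sigma>] .
    show "((\<lambda>k. inverse (real (Suc k))) \<circ> \<sigma>) \<longlonglongrightarrow> 0"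
      using LIMSEQ_subseq_LIMSEQ[OF LIMSEQ_inverse_real_of_nat \<sigma>] .
  qed (use x ne d lim in \<open>auto simp: o_def\<close>)
qed

theorem theorem5p4:
  fixes phi :: "'x::euclidean_space \<Rightarrow> real"
    and h :: "'x \<Rightarrow> 'y::euclidean_space"
    and theta zeta :: "'x \<Rightarrow> real^'n::finite^'n"
    and Dphi :: "'x \<Rightarrow> 'x \<Rightarrow>\<^sub>L real" and D2phi :: "'x \<Rightarrow> 'x \<Rightarrow>\<^sub>L ('x \<Rightarrow>\<^sub>L real)"
    and Dh :: "'x \<Rightarrow> 'x \<Rightarrow>\<^sub>L 'y" and D2h :: "'x \<Rightarrow> 'x \<Rightarrow>\<^sub>L ('x \<Rightarrow>\<^sub>L 'y)"
    and Dtheta :: "'x \<Rightarrow> 'x \<Rightarrow>\<^sub>L (real^'n^'n)" and D2theta :: "'x \<Rightarrow> 'x \<Rightarrow>\<^sub>L ('x \<Rightarrow>\<^sub>L (real^'n^'n))"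
    and Dzeta :: "'x \<Rightarrow> 'x \<Rightarrow>\<^sub>L (real^'n^'n)" and D2zeta :: "'x \<Rightarrow> 'x \<Rightarrow>\<^sub>L ('x \<Rightarrow>\<^sub>L (real^'n^'n))"
    and K :: "'y set"
    and xbar :: 'x
  assumes dphi: "\<And>x. (phi has_derivative blinfun_apply (Dphi x)) (at x)"
      and d2phi: "\<And>x. (Dphi has_derivative blinfun_apply (D2phi x)) (at x)"
      and dh: "\<And>x. (h has_derivative blinfun_apply (Dh x)) (at x)"
      and d2h: "\<And>x. (Dh has_derivative blinfun_apply (D2h x)) (at x)"
      and dtheta: "\<And>x. (theta has_derivative blinfun_apply (Dtheta x)) (at x)"
      and d2theta: "\<And>x. (Dtheta has_derivative blinfun_apply (D2theta x)) (at x)"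
      and dzeta: "\<And>x. (zeta has_derivative blinfun_apply (Dzeta x)) (at x)"
      and d2zeta: "\<And>x. (Dzeta has_derivative blinfun_apply (D2zeta x)) (at x)"
      and theta_sym: "\<And>x. theta x \<in> sym_mats"
      and zeta_sym: "\<And>x. zeta x \<in> sym_mats"
      and K_closed: "closed K" and K_convex: "convex K" and K_cone: "cone K"
      and K_sor: "second_order_regular K"
      and feasible: "h xbar \<in> K" "(theta xbar, zeta xbar) \<in> Omega_set"
      and M_nonempty:
        "{m :: 'y \<times> ((real^'n^'n) \<times> (real^'n^'n)).
            ((\<lambda>x. lagrangian phi h theta zeta x m) has_derivative (\<lambda>_. 0)) (at xbar) \<and>
            m \<in> limiting_normal_cone (UNIV \<times> (sym_mats \<times> sym_mats)) (K \<times> Omega_set)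
                   (h xbar, theta xbar, zeta xbar)} \<noteq> {}"
      and SOSC:
        "\<And>d. d \<noteq> 0 \<Longrightarrow> blinfun_apply (Dphi xbar) d \<le> 0 \<Longrightarrow>
           (blinfun_apply (Dh xbar) d, blinfun_apply (Dtheta xbar) d, blinfun_apply (Dzeta xbar) d)
             \<in> bouligand_tangent_cone (K \<times> Omega_set) (h xbar, theta xbar, zeta xbar) \<Longrightarrow>
           (SUP m \<in> {m :: 'y \<times> ((real^'n^'n) \<times> (real^'n^'n)).
                ((\<lambda>x. lagrangian phi h theta zeta x m) has_derivative (\<lambda>_. 0)) (at xbar) \<and>
                m \<in> limiting_normal_cone (UNIV \<times> (sym_mats \<times> sym_mats)) (K \<times> Omega_set)
                       (h xbar, theta xbar, zeta xbar)}.
              ereal (blinfun_apply (blinfun_apply (D2phi xbar) d) d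
                     + inner (fst m) (blinfun_apply (blinfun_apply (D2h xbar) d) d)
                     + inner (fst (snd m)) (blinfun_apply (blinfun_apply (D2theta xbar) d) d)
                     + inner (snd (snd m)) (blinfun_apply (blinfun_apply (D2zeta xbar) d) d))
              - support_fun m
                  (outer_tangent2 (K \<times> Omega_set) (h xbar, theta xbar, zeta xbar)
                     (blinfun_apply (Dh xbar) d, blinfun_apply (Dtheta xbar) d,
                      blinfun_apply (Dzeta xbar) d))) > 0"
      and subreg:
        "\<And>d. blinfun_apply (Dphi xbar) d \<le> 0 \<Longrightarrow>
           (blinfun_apply (Dh xbar) d, blinfun_apply (Dtheta xbar) d, blinfun_apply (Dzeta xbar) d)
             \<in> bouligand_tangent_cone (K \<times> Omega_set) (h xbar, theta xbar, zeta xbar) \<Longrightarrow>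
           dir_metric_subregular (sym_mats \<times> sym_mats) H_map H_set (theta xbar, zeta xbar)
             (blinfun_apply (Dtheta xbar) d, blinfun_apply (Dzeta xbar) d)"
  shows "\<exists>\<kappa>>0. \<exists>\<delta>>0. \<forall>x. h x \<in> K \<and> (theta x, zeta x) \<in> Omega_set \<and> norm (x - xbar) \<le> \<delta> \<longrightarrow>
           phi x \<ge> phi xbar + \<kappa> * (norm (x - xbar))\<^sup>2"
proof (rule ccontr)
  let ?feas = "\<lambda>x. h x \<in> K \<and> (theta x, zeta x) \<in> Omega_set"
  let ?y = "(h xbar, theta xbar, zeta xbar)"
  assume "\<not> ?thesis"
  then have "\<not> (\<exists>\<kappa>>0. \<exists>\<delta>>0. \<forall>x. ?feas x \<and> norm (x - xbar) \<le> \<delta> \<longrightarrow>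
      phi x \<ge> phi xbar + \<kappa> * (norm (x - xbar))\<^sup>2)" by (simp add: conj_assoc)
  then obtain x e d where feas: "\<And>k. ?feas (x k)" and x: "x \<longlonglongrightarrow> xbar" "\<And>k. x k \<noteq> xbar"
    and e: "e \<longlonglongrightarrow> 0" and less: "\<And>k. phi (x k) < phi xbar + e k * (norm (x k - xbar))\<^sup>2"
    and d: "(\<lambda>k. (1 / norm (x k - xbar)) *\<^sub>R (x k - xbar)) \<longlonglongrightarrow> d" and "norm d = 1"
    by (rule no_quadratic_growth_sequence) (rule that)
  define t where "t k = norm (x k - xbar)" for k
  have t: "0 < t k" for k using x(2)[of k] by (simp add: t_def)
  have t0: "t \<longlonglongrightarrow> 0"
    unfolding t_def using x(1) by (simp add: LIM_zero tendsto_norm_zero)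
  note quot1 = first_order_quotient_tendsto[OF _ _ x d, folded t_def]
  note quot2 = second_order_quotient_tendsto[OF _ _ x d, folded t_def]

  let ?v = "(Dh xbar d, Dtheta xbar d, Dzeta xbar d)"
  have "Dphi xbar d \<le> 0"
  proof (rule LIMSEQ_le)
    show "(\<lambda>k. (1 / t k) *\<^sub>R (phi (x k) - phi xbar)) \<longlonglongrightarrow> Dphi xbar d"
      by (rule quot1[OF dphi d2phi])
    show "(\<lambda>k. e k * t k) \<longlonglongrightarrow> 0" using tendsto_mult[OF e t0] by simp
    show "\<exists>N. \<forall>k\<ge>N. (1 / t k) *\<^sub>R (phi (x k) - phi xbar) \<le> e k * t k"
    proof (intro exI allI impI)
      fix k
      show "(1 / t k) *\<^sub>R (phi (x k) - phi xbar) \<le> e k * t k"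
        using less[of k] t[of k] by (simp add: t_def[symmetric] field_simps power2_eq_square)
    qed
  qed
  moreover have "?v \<in> bouligand_tangent_cone (K \<times> Omega_set) ?y"
  proof -
    let ?dd = "\<lambda>k. ((1 / t k) *\<^sub>R (h (x k) - h xbar), (1 / t k) *\<^sub>R (theta (x k) - theta xbar),
      (1 / t k) *\<^sub>R (zeta (x k) - zeta xbar))"
    have "?dd \<longlonglongrightarrow> ?v"
      by (intro tendsto_Pair quot1[OF dh d2h] quot1[OF dtheta d2theta] quot1[OF dzeta d2zeta])
    moreover have "?y + t k *\<^sub>R ?dd k \<in> K \<times> Omega_set" for k
      using feas[of k] t[of k] by simp
    ultimately show ?thesis
      unfolding bouligand_tangent_cone_def using t t0 by (intro CollectI exI[of _ t] exI[of _ ?dd]) simp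
  qed
  moreover have "d \<noteq> 0" using \<open>norm d = 1\<close> by auto
  moreover define T2 where "T2 = outer_tangent2 (K \<times> Omega_set) ?y ?v"
  \<comment> \<open>A supremum above 0 is exceeded by 0 at no loss: some single multiplier already
    has a positive value, whether or not the supremum is attained.\<close>
  ultimately obtain m
    where m: "((\<lambda>x. lagrangian phi h theta zeta x m) has_derivative (\<lambda>_. 0)) (at xbar)"
    and pos: "ereal (blinfun_apply (blinfun_apply (D2phi xbar) d) d
                     + inner (fst m) (blinfun_apply (blinfun_apply (D2h xbar) d) d)
                     + inner (fst (snd m)) (blinfun_apply (blinfun_apply (D2theta xbar) d) d)
                     + inner (snd (snd m)) (blinfun_apply (blinfun_apply (D2zeta xbar) d) d))
              - support_fun m T2 > 0" (is "ereal ?q - _ > 0")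
    and sr: "dir_metric_subregular (sym_mats \<times> sym_mats) H_map H_set (theta xbar, zeta xbar)
             (Dtheta xbar d, Dzeta xbar d)"
    using SOSC[of d] subreg[of d] unfolding less_SUP_iff by blast

  \<comment> \<open>The derivative is taken at \<open>d\<close>, not at \<open>x k - xbar\<close>,
    so that the parabola has the fixed direction \<open>?v\<close>. The quotients may be unbounded;
    by \<open>scaled\<close> they vanish after multiplication by \<open>t k\<close>.\<close>
  define wh where "wh k = (2 / (t k)\<^sup>2) *\<^sub>R (h (x k) - h xbar - t k *\<^sub>R Dh xbar d)" for k
  define wt where "wt k = (2 / (t k)\<^sup>2) *\<^sub>R (theta (x k) - theta xbar - t k *\<^sub>R Dtheta xbar d)" for k
  define wz where "wz k = (2 / (t k)\<^sup>2) *\<^sub>R (zeta (x k) - zeta xbar - t k *\<^sub>R Dzeta xbar d)" for k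
  define w where "w k = (wh k, wt k, wz k)" for k
  have scaled: "(\<lambda>k. t k *\<^sub>R ((2 / (t k)\<^sup>2) *\<^sub>R (f (x k) - c - t k *\<^sub>R b))) \<longlonglongrightarrow> 0"
    if "(\<lambda>k. (1 / t k) *\<^sub>R (f (x k) - c)) \<longlonglongrightarrow> b" for f :: "'x \<Rightarrow> 'b::real_normed_vector" and b c
  proof -
    have "(\<lambda>k. 2 *\<^sub>R ((1 / t k) *\<^sub>R (f (x k) - c) - b)) \<longlonglongrightarrow> 2 *\<^sub>R (b - b)"
      by (intro tendsto_intros that)
    moreover have "2 *\<^sub>R ((1 / t k) *\<^sub>R (f (x k) - c) - b) = t k *\<^sub>R ((2 / (t k)\<^sup>2) *\<^sub>R (f (x k) - c - t k *\<^sub>R b))" for k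
      using t[of k] by (simp add: scaleR_diff_right power2_eq_square)
    ultimately show ?thesis by simp
  qed
  have near: "\<forall>\<^sub>F k in sequentially. \<exists>z\<in>T2. dist (w k) z < \<epsilon>" if \<epsilon>: "\<epsilon> > 0" for \<epsilon>
  proof -
    have near_K: "\<forall>\<^sub>F k in sequentially. \<exists>z\<in>outer_tangent2 K (h xbar) (Dh xbar d). dist (wh k) z < \<epsilon> / 2"
      and inner_outer: "outer_tangent2 K (h xbar) (Dh xbar d) = inner_tangent2 K (h xbar) (Dh xbar d)"
    proof -
      have "Dh xbar d \<in> bouligand_tangent_cone K (h xbar)"
      proof -
        have "\<forall>k. h xbar + t k *\<^sub>R (1 / t k) *\<^sub>R (h (x k) - h xbar) \<in> K"
          using feas t by (simp add: less_imp_neq[THEN not_sym])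
        then show ?thesis
          unfolding bouligand_tangent_cone_def using t t0 quot1[OF dh d2h]
          by (intro CollectI exI[of _ t] exI[of _ "\<lambda>k. (1 / t k) *\<^sub>R (h (x k) - h xbar)"] conjI) auto
      qed
      note sor = K_sor[unfolded second_order_regular_def, rule_format, OF feasible(1) this]
      show "outer_tangent2 K (h xbar) (Dh xbar d) = inner_tangent2 K (h xbar) (Dh xbar d)"
        using sor by blast
      have "h xbar + t k *\<^sub>R Dh xbar d + ((t k)\<^sup>2 / 2) *\<^sub>R wh k \<in> K" for k
        using feas[of k] t[of k] by (simp add: wh_def)
      moreover have "(\<lambda>k. t k *\<^sub>R wh k) \<longlonglongrightarrow> 0"
        unfolding wh_def by (intro scaled quot1[OF dh d2h])
      ultimately show "\<forall>\<^sub>F k in sequentially. \<exists>z\<in>outer_tangent2 K (h xbar) (Dh xbar d). dist (wh k) z < \<epsilon> / 2"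
        using sor[THEN conjunct2, rule_format, of t wh "\<epsilon> / 2"] t t0 \<epsilon> by simp
    qed
    have near_Omega: "\<forall>\<^sub>F k in sequentially. \<exists>z\<in>outer_tangent2 Omega_set (theta xbar, zeta xbar) (Dtheta xbar d, Dzeta xbar d).
      dist (wt k, wz k) z < \<epsilon> / 2"
    proof (rule Omega_set_parabola_near_tangent2[OF t t0 feasible(2) _ _ sr])
      show "(theta xbar, zeta xbar) + t k *\<^sub>R (Dtheta xbar d, Dzeta xbar d) + ((t k)\<^sup>2 / 2) *\<^sub>R (wt k, wz k) \<in> Omega_set" for k
        using feas[of k] t[of k] by (simp add: wt_def wz_def)
      have "(\<lambda>k. (t k *\<^sub>R wt k, t k *\<^sub>R wz k)) \<longlonglongrightarrow> (0, 0)"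
        unfolding wt_def wz_def by (intro tendsto_Pair scaled quot1[OF dtheta d2theta] quot1[OF dzeta d2zeta])
      then show "(\<lambda>k. t k *\<^sub>R (wt k, wz k)) \<longlonglongrightarrow> 0" by (simp add: zero_prod_def)
    qed (use \<epsilon> in simp)
    from near_K near_Omega show ?thesis
    proof eventually_elim
      case (elim k)
      then obtain a b where a: "a \<in> outer_tangent2 K (h xbar) (Dh xbar d)" "dist (wh k) a < \<epsilon> / 2"
        and b: "b \<in> outer_tangent2 Omega_set (theta xbar, zeta xbar) (Dtheta xbar d, Dzeta xbar d)"
          "dist (wt k, wz k) b < \<epsilon> / 2" by blast
      \<comment> \<open>By second-order regularity \<open>a\<close> is inner tangent, so it follows
        the sequence belonging to \<open>b\<close>.\<close>
      have "(a, b) \<in> T2"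
        unfolding T2_def using a(1) b(1) feasible inner_outer by (intro outer_tangent2_Times) auto
      moreover have "dist (w k) (a, b) \<le> dist (wh k) a + dist (wt k, wz k) b"
        unfolding w_def dist_Pair_Pair[of "wh k"] by (rule sqrt_sum_squares_le_sum) simp_all
      ultimately show ?case using a(2) b(2) by (intro bexI[of _ "(a, b)"]) auto
    qed
  qed

  \<comment> \<open>Nonemptiness of \<open>T2\<close> excludes the value minus infinity of the
    support function, and \<open>pos\<close> excludes plus infinity.\<close>
  from near[of 1] obtain z0 where z0: "z0 \<in> T2" by (auto simp: eventually_sequentially)
  have le_support: "ereal (inner m z) \<le> support_fun m T2" if "z \<in> T2" for z
    unfolding support_fun_def using that by (rule SUP_upper)
  obtain s where s: "support_fun m T2 = ereal s"
    using le_support[OF z0] pos by (cases "support_fun m T2") auto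
  define q where "q = ?q"
  have "s < q" using pos unfolding s q_def by simp
  have inner_le: "inner m z \<le> s" if "z \<in> T2" for z using le_support[OF that] by (simp add: s)
  have "inner m ?v = 0"
    by (rule orthogonal_if_bounded_on_outer_tangent2[OF z0[unfolded T2_def] inner_le[unfolded T2_def]])
  then have mv: "inner (fst m) (Dh xbar d) + inner (fst (snd m)) (Dtheta xbar d) + inner (snd (snd m)) (Dzeta xbar d) = 0"
    by (simp add: inner_prod_def add.assoc)

  have stationary: "Dphi xbar u + inner (fst m) (Dh xbar u) + inner (fst (snd m)) (Dtheta xbar u)
      + inner (snd (snd m)) (Dzeta xbar u) = 0" for u
  proof -
    have "((\<lambda>x. lagrangian phi h theta zeta x m) has_derivative
      (\<lambda>u. Dphi xbar u + inner (fst m) (Dh xbar u) + inner (fst (snd m)) (Dtheta xbar u)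
        + inner (snd (snd m)) (Dzeta xbar u))) (at xbar)"
      unfolding lagrangian_def inner_prod_def fst_conv snd_conv
      by (auto intro!: derivative_eq_intros dphi dh dtheta dzeta)
    from fun_cong[OF has_derivative_unique[OF m this], of u] show ?thesis by simp
  qed
  \<comment> \<open>Here the derivatives are at \<open>x k - xbar\<close>, so \<open>r\<close>
    converges to the second derivative of the Lagrangian at \<open>d\<close>. Derivative terms drop
    out of \<open>r k\<close> by \<open>stationary\<close> and out of \<open>inner m (w k)\<close>
    by \<open>mv\<close>, so the two differ only by the scaled increment of
    \<open>phi\<close>.\<close>
  define r where "r k = (2 / (t k)\<^sup>2) *\<^sub>R (phi (x k) - phi xbar - Dphi xbar (x k - xbar))
    + inner (fst m) ((2 / (t k)\<^sup>2) *\<^sub>R (h (x k) - h xbar - Dh xbar (x k - xbar)))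
    + inner (fst (snd m)) ((2 / (t k)\<^sup>2) *\<^sub>R (theta (x k) - theta xbar - Dtheta xbar (x k - xbar)))
    + inner (snd (snd m)) ((2 / (t k)\<^sup>2) *\<^sub>R (zeta (x k) - zeta xbar - Dzeta xbar (x k - xbar)))" for k
  have "r \<longlonglongrightarrow> q"
    unfolding r_def q_def
    by (intro tendsto_intros quot2[OF dphi d2phi] quot2[OF dh d2h] quot2[OF dtheta d2theta] quot2[OF dzeta d2zeta])
  moreover have lower: "r k - 2 * e k \<le> inner m (w k)" for k
  proof -
    let ?S = "\<lambda>a b c. inner (fst m) a + inner (fst (snd m)) b + inner (snd (snd m)) c"
    let ?D = "?S (h (x k) - h xbar) (theta (x k) - theta xbar) (zeta (x k) - zeta xbar)"
    have "r k = 2 / (t k)\<^sup>2 * (phi (x k) - phi xbar + ?D - (Dphi xbar (x k - xbar)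
        + inner (fst m) (Dh xbar (x k - xbar)) + inner (fst (snd m)) (Dtheta xbar (x k - xbar))
        + inner (snd (snd m)) (Dzeta xbar (x k - xbar))))"
      unfolding r_def by (simp only: inner_scaleR_right inner_diff_right real_scaleR_def)
        (simp add: algebra_simps add_divide_distrib)
    then have rk: "r k = 2 / (t k)\<^sup>2 * (phi (x k) - phi xbar) + 2 / (t k)\<^sup>2 * ?D"
      unfolding stationary by (simp only: diff_zero distrib_left)
    have "inner m (w k) = 2 / (t k)\<^sup>2 * (?D - t k * ?S (Dh xbar d) (Dtheta xbar d) (Dzeta xbar d))"
      unfolding w_def wh_def wt_def wz_def inner_prod_def fst_conv snd_conv
      by (simp only: inner_scaleR_right inner_diff_right) (simp add: algebra_simps)
    then have wk: "inner m (w k) = 2 / (t k)\<^sup>2 * ?D" unfolding mv by simp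
    have "2 / (t k)\<^sup>2 * (phi (x k) - phi xbar) \<le> 2 / (t k)\<^sup>2 * (e k * (t k)\<^sup>2)"
      using less[of k] by (intro mult_left_mono) (auto simp: t_def)
    also have "\<dots> = 2 * e k" using t[of k] by simp
    finally show ?thesis unfolding rk wk by simp
  qed
  \<comment> \<open>At this distance the values of \<open>m\<close> differ by at most half the gap
    \<open>q - s\<close>, which the midpoint \<open>(q + s) / 2\<close> then contradicts. Adding 1
    covers \<open>m = 0\<close>.\<close>
  moreover define \<eta> where "\<eta> = (q - s) / (2 * (norm m + 1))"
  have "\<eta> > 0" using \<open>s < q\<close> by (simp add: \<eta>_def add_nonneg_pos)
  ultimately have "(\<lambda>k. r k - 2 * e k) \<longlonglongrightarrow> q - 2 * 0"
    by (intro tendsto_intros e)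
  then have "\<forall>\<^sub>F k in sequentially. (q + s) / 2 < r k - 2 * e k"
    by (rule order_tendstoD(1)) (use \<open>s < q\<close> in simp)
  with near[OF \<open>\<eta> > 0\<close>] have "\<forall>\<^sub>F k in sequentially. False"
  proof eventually_elim
    case (elim k)
    then obtain z where z: "z \<in> T2" "dist (w k) z < \<eta>" by blast
    have "inner m (w k - z) \<le> norm m * norm (w k - z)" by (rule norm_cauchy_schwarz)
    also have "\<dots> \<le> (norm m + 1) * \<eta>"
      using z(2) by (intro mult_mono) (auto simp: dist_norm)
    also have "\<dots> = (q - s) / 2"
    proof -
      have "norm m + 1 \<noteq> 0" using norm_ge_zero[of m] by linarith
      then show ?thesis unfolding \<eta>_def by (simp add: field_simps)
    qed
    finally have "inner m (w k) \<le> s + (q - s) / 2"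
      using inner_le[OF z(1)] unfolding inner_diff_right by linarith
    also have "s + (q - s) / 2 = (q + s) / 2" by (simp add: field_simps)
    also have "\<dots> < r k - 2 * e k" by (rule elim(2))
    also have "\<dots> \<le> inner m (w k)" by (rule lower)
    finally show False by simp
  qed
  then show False by simp
qed

end
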